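(* Let $T^*\mathbb{R}^3$, with coordinates $(\bm q,\bm p)=(q_1,q_2,q_3,p_1,p_2,p_3)$, be the $6$-dimensional symplectic manifold with standard symplectic form $\omega=\sum_{i=1}^3 dq_i\wedge dp_i$. Let $H(\bm q,\bm p)=\|\bm p\|^2-n(\bm q)^2$ be the optical Hamiltonian, where $n(\bm q)>0$ is the refractive index function. Let $\Sigma=H^{-1}(0)=\{(\bm q,\bm p)\in T^*\mathbb{R}^3:\|\bm p\|=n(\bm q)\}$ be the $5$-dimensional constraint hypersurface, let $\alpha=\theta|_\Sigma$, where $\theta=\sum_{i=1}^3 p_i\,dq_i$ is the Liouville form, and let $X_H$ be the Hamiltonian vector field, satisfying $\iota_{X_H}\omega=dH$. Then the following hold: 1. $(\Sigma,\alpha)$ is a contact manifold. 2. There exists a unique Reeb vector field $R$ satisfying $\iota_R d\alpha=0$ and $\iota_R\alpha=1$. 3. The restriction of the Hamiltonian vector field to $\Sigma$ is proportional to the Reeb vector field: $X_H|_\Sigma=2n(\bm q)^2R$. 4. Rays in three-dimensional space correspond to Reeb orbits on $\Sigma$.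
   Context: That $(\Sigma,\alpha)$ is a contact manifold means that $\alpha\wedge(d\alpha)^2$ is nowhere zero on the $5$-dimensional manifold $\Sigma$. The Reeb orbits are the integral curves of the Reeb vector field $R$. A ray in $\mathbb{R}^3$ is a light propagation path in the medium of refractive index $n$, i.e. a curve $\bm q(s)$ satisfying $\frac{d}{ds}\left(n(\bm q)\frac{d\bm q}{ds}\right)=\nabla n(\bm q)$ with $s$ the arc length (equivalently, an extremal of the optical path $\int n(\bm q)\,ds$). In $T^*\mathbb{R}^3$, rays are described by curves $(\bm q(t),\bm p(t))$ with $H(\bm q,\bm p)=0$, $\frac{d\bm q}{dt}=2\bm p$, $\frac{d\bm p}{dt}=2n(\bm q)\nabla n(\bm q)$. $\iota$ denotes contraction (interior product) and $\|\cdot\|$ is the Euclidean norm. *)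

theory Defs
  imports "HOL-Analysis.Analysis"
begin

section \<open>Smooth maps on open sets\<close>

primrec Ck_on ::
  "nat \<Rightarrow> 'a::euclidean_space set \<Rightarrow> ('a \<Rightarrow> 'b::real_normed_vector) \<Rightarrow> bool" where
  "Ck_on 0 S f \<longleftrightarrow> continuous_on S f"
| "Ck_on (Suc k) S f \<longleftrightarrow> (\<forall>x\<in>S. f differentiable (at x)) \<and>
     (\<forall>v. Ck_on k S (\<lambda>x. frechet_derivative f (at x) v))"

text \<open>Only meaningful for open \<open>S\<close>, as the derivatives are taken in the ambient space.\<close>

definition smooth_on ::
  "'a::euclidean_space set \<Rightarrow> ('a \<Rightarrow> 'b::real_normed_vector) \<Rightarrow> bool" where
  "smooth_on S f \<longleftrightarrow> (\<forall>k. Ck_on k S f)"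

definition grad :: "('a::real_inner \<Rightarrow> real) \<Rightarrow> 'a \<Rightarrow> 'a" where
  "grad f x = (THE D. GDERIV f x :> D)"


section \<open>Differential forms\<close>

text \<open>An alternating \<open>k\<close>-form on a vector space is a real function of a sequence of vectors of which
  only the entries \<open>v 0, \<dots>, v (k - 1)\<close> matter. The degree is passed to the operations explicitly.\<close>

type_synonym 'a alt = "(nat \<Rightarrow> 'a) \<Rightarrow> real"

text \<open>The normalisation of the wedge product is the one with
  \<open>(a \<and> b)(v, w) = a v * b w - a w * b v\<close> for 1-forms \<open>a\<close> and \<open>b\<close>.\<close>

definition wedge :: "nat \<Rightarrow> nat \<Rightarrow> 'a alt \<Rightarrow> 'a alt \<Rightarrow> 'a alt" where
  "wedge k l a b v = (\<Sum>\<sigma> | \<sigma> permutes {..<k + l}.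
     of_int (sign \<sigma>) * a (\<lambda>i. v (\<sigma> i)) * b (\<lambda>i. v (\<sigma> (k + i)))) / (fact k * fact l)"

definition contract :: "'a \<Rightarrow> 'a alt \<Rightarrow> 'a alt" where
  "contract X a v = a (case_nat X v)"

text \<open>The exterior derivative of a \<open>k\<close>-form on an open subset of a Euclidean space:
  \<open>d\<eta> (v 0, \<dots>, v k)\<close> is the alternating sum over \<open>i\<close> of the derivatives in direction \<open>v i\<close>
  of \<open>\<eta>\<close> applied to the remaining (constant) vectors.\<close>

definition ext_deriv :: "nat \<Rightarrow> ('a::euclidean_space \<Rightarrow> 'a alt) \<Rightarrow> 'a \<Rightarrow> 'a alt" where
  "ext_deriv k \<eta> x v = (\<Sum>i\<le>k. (- 1) ^ i *
     frechet_derivative (\<lambda>y. \<eta> y (\<lambda>j. if j < i then v j else v (Suc j))) (at x) (v i))"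

definition pullback ::
  "('m::euclidean_space \<Rightarrow> 'a::euclidean_space) \<Rightarrow> ('a \<Rightarrow> 'a alt) \<Rightarrow> 'm \<Rightarrow> 'm alt" where
  "pullback \<phi> \<eta> u a = \<eta> (\<phi> u) (\<lambda>i. frechet_derivative \<phi> (at u) (a i))"


section \<open>Embedded submanifolds of Euclidean spaces\<close>

definition local_param ::
  "'a::euclidean_space set \<Rightarrow> 'm::euclidean_space set \<Rightarrow> ('m \<Rightarrow> 'a) \<Rightarrow> bool" where
  "local_param M U \<phi> \<longleftrightarrow> open U \<and> smooth_on U \<phi> \<and>
     (\<forall>u\<in>U. inj (frechet_derivative \<phi> (at u))) \<and>
     openin (top_of_set M) (\<phi> ` U) \<and> (\<exists>\<psi>. homeomorphism U (\<phi> ` U) \<phi> \<psi>)"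

text \<open>\<open>submanifold TYPE('m) M\<close>: \<open>M\<close> is a smooth embedded submanifold of dimension \<open>DIM('m)\<close>.\<close>

definition submanifold :: "'m::euclidean_space itself \<Rightarrow> 'a::euclidean_space set \<Rightarrow> bool" where
  "submanifold T M \<longleftrightarrow>
     (\<forall>x\<in>M. \<exists>U (\<phi> :: 'm \<Rightarrow> 'a). local_param M U \<phi> \<and> x \<in> \<phi> ` U)"

definition tangent_space :: "'a::euclidean_space set \<Rightarrow> 'a \<Rightarrow> 'a set" where
  "tangent_space M x = {v. \<exists>\<gamma> \<epsilon>. \<epsilon> > 0 \<and> smooth_on {-\<epsilon><..<\<epsilon>} \<gamma> \<and> \<gamma> ` {-\<epsilon><..<\<epsilon>} \<subseteq> M \<and>
     \<gamma> 0 = x \<and> (\<gamma> has_vector_derivative v) (at (0::real))}"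

text \<open>A form on \<open>M\<close> is evaluated only at points of \<open>M\<close> and at vectors tangent to \<open>M\<close> there; the
  restriction of an ambient form forgets everything else.\<close>

definition restrict_form ::
  "nat \<Rightarrow> 'a::euclidean_space set \<Rightarrow> ('a \<Rightarrow> 'a alt) \<Rightarrow> 'a \<Rightarrow> 'a alt" where
  "restrict_form k M \<eta> x v =
     (if x \<in> M \<and> (\<forall>i<k. v i \<in> tangent_space M x) then \<eta> x v else 0)"

text \<open>Smooth differential \<open>k\<close>-forms on \<open>M\<close>, expressed in all local parametrisations.\<close>

definition form_on ::
  "'m::euclidean_space itself \<Rightarrow> nat \<Rightarrow> 'a::euclidean_space set \<Rightarrow> ('a \<Rightarrow> 'a alt) \<Rightarrow> bool" where
  "form_on T k M \<alpha> \<longleftrightarrow> (\<forall>U (\<phi> :: 'm \<Rightarrow> 'a). local_param M U \<phi> \<longrightarrow>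
     (\<forall>u\<in>U.
       (\<forall>a b. (\<forall>i<k. a i = b i) \<longrightarrow> pullback \<phi> \<alpha> u a = pullback \<phi> \<alpha> u b) \<and>
       (\<forall>a. \<forall>i<k. linear (\<lambda>b. pullback \<phi> \<alpha> u (a(i := b)))) \<and>
       (\<forall>a. \<forall>i<k. \<forall>j<k. i \<noteq> j \<longrightarrow> a i = a j \<longrightarrow> pullback \<phi> \<alpha> u a = 0)) \<and>
     (\<forall>a. smooth_on U (\<lambda>u. pullback \<phi> \<alpha> u a)))"

text \<open>The exterior derivative on \<open>M\<close> of a \<open>k\<close>-form on \<open>M\<close> is the form whose pullback along every
  local parametrisation is the exterior derivative of the pulled back form.\<close>

definition ext_deriv_on :: "'m::euclidean_space itself \<Rightarrow> nat \<Rightarrow> 'a::euclidean_space set \<Rightarrow>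
    ('a \<Rightarrow> 'a alt) \<Rightarrow> 'a \<Rightarrow> 'a alt" where
  "ext_deriv_on T k M \<alpha> x v = (THE c. \<forall>U (\<phi> :: 'm \<Rightarrow> 'a) u a.
     local_param M U \<phi> \<longrightarrow> u \<in> U \<longrightarrow> \<phi> u = x \<longrightarrow>
     (\<forall>i\<le>k. frechet_derivative \<phi> (at u) (a i) = v i) \<longrightarrow> c = ext_deriv k (pullback \<phi> \<alpha>) u a)"

text \<open>A vector field on \<open>M\<close> is an extensional function (\<open>undefined\<close> outside \<open>M\<close>), so that
  equality of vector fields is equality of functions.\<close>

definition vector_field_on :: "'a::euclidean_space set \<Rightarrow> ('a \<Rightarrow> 'a) \<Rightarrow> bool" where
  "vector_field_on M X \<longleftrightarrow> X \<in> extensional M \<and> (\<forall>x\<in>M. X x \<in> tangent_space M x) \<and>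
     (\<forall>x\<in>M. \<exists>W Y. open W \<and> x \<in> W \<and> smooth_on W Y \<and> (\<forall>y\<in>W \<inter> M. Y y = X y))"


section \<open>Contact manifolds of dimension five\<close>

definition contact_manifold_5 ::
  "'a::euclidean_space set \<Rightarrow> ('a \<Rightarrow> 'a alt) \<Rightarrow> bool" where
  "contact_manifold_5 M \<alpha> \<longleftrightarrow> submanifold TYPE(real^5) M \<and> form_on TYPE(real^5) 1 M \<alpha> \<and>
     (\<forall>x\<in>M. \<exists>v. (\<forall>i<5. v i \<in> tangent_space M x) \<and>
       (let d\<alpha> = ext_deriv_on TYPE(real^5) 1 M \<alpha>
        in wedge 1 4 (\<alpha> x) (wedge 2 2 (d\<alpha> x) (d\<alpha> x)) v \<noteq> 0))"

definition reeb_field_5 ::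
  "'a::euclidean_space set \<Rightarrow> ('a \<Rightarrow> 'a alt) \<Rightarrow> ('a \<Rightarrow> 'a) \<Rightarrow> bool" where
  "reeb_field_5 M \<alpha> R \<longleftrightarrow> vector_field_on M R \<and>
     (\<forall>x\<in>M. (\<forall>v. v 0 \<in> tangent_space M x \<longrightarrow>
               contract (R x) (ext_deriv_on TYPE(real^5) 1 M \<alpha> x) v = 0) \<and>
             (\<forall>v. contract (R x) (\<alpha> x) v = 1))"


section \<open>The phase space of geometrical optics\<close>

text \<open>\<open>T\<^sup>*\<real>\<^sup>3\<close> with points \<open>(q, p)\<close>.\<close>

type_synonym phase = "(real^3) \<times> (real^3)"

definition dq :: "3 \<Rightarrow> phase \<Rightarrow> phase alt" where
  "dq i = ext_deriv 0 (\<lambda>z _. fst z $ i)"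

definition dp :: "3 \<Rightarrow> phase \<Rightarrow> phase alt" where
  "dp i = ext_deriv 0 (\<lambda>z _. snd z $ i)"

definition symplectic_form :: "phase \<Rightarrow> phase alt" where
  "symplectic_form z v = (\<Sum>i\<in>UNIV. wedge 1 1 (dq i z) (dp i z) v)"

definition liouville_form :: "phase \<Rightarrow> phase alt" where
  "liouville_form z v = (\<Sum>i\<in>UNIV. snd z $ i * dq i z v)"

definition is_hamiltonian_vector_field :: "(phase \<Rightarrow> real) \<Rightarrow> (phase \<Rightarrow> phase) \<Rightarrow> bool" where
  "is_hamiltonian_vector_field H X \<longleftrightarrow>
     (\<forall>z. contract (X z) (symplectic_form z) = ext_deriv 0 (\<lambda>y _. H y) z)"

definition optical_hamiltonian :: "(real^3 \<Rightarrow> real) \<Rightarrow> phase \<Rightarrow> real" where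
  "optical_hamiltonian n z = (norm (snd z))\<^sup>2 - (n (fst z))\<^sup>2"

definition optical_hypersurface :: "(real^3 \<Rightarrow> real) \<Rightarrow> phase set" where
  "optical_hypersurface n = optical_hamiltonian n -` {0}"

lemma optical_hypersurface_eq:
  assumes "\<And>q. n q > 0"
  shows "optical_hypersurface n = {z. norm (snd z) = n (fst z)}"
  using assms
  by (auto simp: optical_hypersurface_def optical_hamiltonian_def less_imp_le power2_eq_iff_nonneg)

definition optical_contact_form :: "(real^3 \<Rightarrow> real) \<Rightarrow> phase \<Rightarrow> phase alt" where
  "optical_contact_form n = restrict_form 1 (optical_hypersurface n) liouville_form"


section \<open>Rays and orbits\<close>

definition open_interval :: "real set \<Rightarrow> bool" where
  "open_interval I \<longleftrightarrow> open I \<and> is_interval I \<and> I \<noteq> {}"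

text \<open>Rays parametrised by arc length.\<close>

definition is_ray :: "(real^3 \<Rightarrow> real) \<Rightarrow> real set \<Rightarrow> (real \<Rightarrow> real^3) \<Rightarrow> bool" where
  "is_ray n I q \<longleftrightarrow> open_interval I \<and> (\<forall>s\<in>I. q differentiable (at s) \<and>
     norm (vector_derivative q (at s)) = 1 \<and>
     ((\<lambda>r. n (q r) *\<^sub>R vector_derivative q (at r)) has_vector_derivative grad n (q s)) (at s))"

text \<open>The description of rays in phase space by Hamilton's equations on the zero level of the
  optical Hamiltonian; here the parameter is not the arc length.\<close>

definition is_phase_space_ray :: "(real^3 \<Rightarrow> real) \<Rightarrow> real set \<Rightarrow> (real \<Rightarrow> phase) \<Rightarrow> bool" where
  "is_phase_space_ray n I c \<longleftrightarrow> open_interval I \<and> (\<forall>t\<in>I. optical_hamiltonian n (c t) = 0 \<and>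
     ((\<lambda>r. fst (c r)) has_vector_derivative 2 *\<^sub>R snd (c t)) (at t) \<and>
     ((\<lambda>r. snd (c r)) has_vector_derivative
        (2 * n (fst (c t))) *\<^sub>R grad n (fst (c t))) (at t))"

definition integral_curve ::
  "'a::real_normed_vector set \<Rightarrow> ('a \<Rightarrow> 'a) \<Rightarrow> real set \<Rightarrow> (real \<Rightarrow> 'a) \<Rightarrow> bool" where
  "integral_curve M X I \<gamma> \<longleftrightarrow> open_interval I \<and>
     (\<forall>t\<in>I. \<gamma> t \<in> M \<and> (\<gamma> has_vector_derivative X (\<gamma> t)) (at t))"

text \<open>The curve \<open>c\<close> on \<open>I\<close> is an orientation-preserving \<open>C\<^sup>1\<close> reparametrisation of the
  curve \<open>g\<close> on \<open>J\<close>.\<close>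

definition reparametrises ::
  "real set \<Rightarrow> (real \<Rightarrow> 'b) \<Rightarrow> real set \<Rightarrow> (real \<Rightarrow> 'b) \<Rightarrow> bool" where
  "reparametrises I c J g \<longleftrightarrow> (\<exists>\<tau> \<tau>'. \<tau> ` I = J \<and> continuous_on I \<tau>' \<and>
     (\<forall>t\<in>I. (\<tau> has_real_derivative \<tau>' t) (at t) \<and> \<tau>' t > 0 \<and> c t = g (\<tau> t)))"

definition equal_up_to_shift ::
  "real set \<Rightarrow> (real \<Rightarrow> 'b) \<Rightarrow> real set \<Rightarrow> (real \<Rightarrow> 'b) \<Rightarrow> bool" where
  "equal_up_to_shift I c J g \<longleftrightarrow> (\<exists>b. J = (\<lambda>t. t + b) ` I \<and> (\<forall>t\<in>I. g (t + b) = c t))"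

text \<open>Correspondence between rays and the integral curves of a vector field \<open>R\<close> on the optical
  hypersurface, both with their natural parametrisations considered up to a shift: a ray
  corresponds to an orbit if it is the projection of the orbit to configuration space, up to the
  change of parameter, and this relation is one-to-one in both directions. The phase space
  rays are the orbits themselves up to the change of parameter.\<close>

definition rays_correspond_to_orbits :: "(real^3 \<Rightarrow> real) \<Rightarrow> (phase \<Rightarrow> phase) \<Rightarrow> bool" where
  "rays_correspond_to_orbits n R \<longleftrightarrow>
     (let orbit = integral_curve (optical_hypersurface n) R;
          projects_to = (\<lambda>J \<gamma> I q. reparametrises I q J (\<lambda>t. fst (\<gamma> t)))
      in (\<forall>I q. is_ray n I q \<longrightarrow> (\<exists>J \<gamma>. orbit J \<gamma> \<and> projects_to J \<gamma> I q)) \<and>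
         (\<forall>J \<gamma>. orbit J \<gamma> \<longrightarrow> (\<exists>I q. is_ray n I q \<and> projects_to J \<gamma> I q)) \<and>
         (\<forall>I q J\<^sub>1 \<gamma>\<^sub>1 J\<^sub>2 \<gamma>\<^sub>2. is_ray n I q \<longrightarrow>
            orbit J\<^sub>1 \<gamma>\<^sub>1 \<longrightarrow> projects_to J\<^sub>1 \<gamma>\<^sub>1 I q \<longrightarrow>
            orbit J\<^sub>2 \<gamma>\<^sub>2 \<longrightarrow> projects_to J\<^sub>2 \<gamma>\<^sub>2 I q \<longrightarrow> equal_up_to_shift J\<^sub>1 \<gamma>\<^sub>1 J\<^sub>2 \<gamma>\<^sub>2) \<and>
         (\<forall>J \<gamma> I\<^sub>1 q\<^sub>1 I\<^sub>2 q\<^sub>2. orbit J \<gamma> \<longrightarrow>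
            is_ray n I\<^sub>1 q\<^sub>1 \<longrightarrow> projects_to J \<gamma> I\<^sub>1 q\<^sub>1 \<longrightarrow>
            is_ray n I\<^sub>2 q\<^sub>2 \<longrightarrow> projects_to J \<gamma> I\<^sub>2 q\<^sub>2 \<longrightarrow> equal_up_to_shift I\<^sub>1 q\<^sub>1 I\<^sub>2 q\<^sub>2) \<and>
         (\<forall>I c. is_phase_space_ray n I c \<longrightarrow> (\<exists>J \<gamma>. orbit J \<gamma> \<and> reparametrises I c J \<gamma>)) \<and>
         (\<forall>J \<gamma>. orbit J \<gamma> \<longrightarrow> (\<exists>I c. is_phase_space_ray n I c \<and> reparametrises I c J \<gamma>)))"

end

theory Submission
  imports Defs
begin

text \<open>On \<open>\<Sigma>\<close> the tangent space is the kernel of \<open>dH\<close>, and \<open>d\<alpha>\<close> is the restriction of \<open>-\<omega>\<close>.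
  A vector \<open>R\<close> with \<open>\<omega>(R, \<cdot>)\<close> vanishing on \<open>ker dH\<close> is a multiple of \<open>X\<^sub>H\<close>, and
  \<open>\<alpha>(X\<^sub>H) = 2\<parallel>p\<parallel>\<^sup>2 = 2n\<^sup>2\<close> is nowhere zero, so that \<open>R = (p / n\<^sup>2, \<nabla>n / n)\<close>. Along an orbit
  \<open>\<parallel>dq/dt\<parallel> = 1 / n\<close>; with the arc length as parameter the orbit equations become \<open>n dq/ds = p\<close> and
  \<open>dp/ds = \<nabla>n\<close>, which is the ray equation.\<close>

section \<open>Calculus of smooth maps\<close>

text \<open>Tangent vectors are defined by curves and \<open>ext_deriv_on\<close> by a definite
  description over all parametrisations by open subsets of \<open>real^5\<close>, so nothing on
  \<Sigma> can be evaluated before charts exist; explicit stereographic charts take the place of an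
  implicit function argument. The differential of a chart is injective, so its range is a
  5-dimensional subspace of the hyperplane ker dH and fills it. That d\<alpha> does not depend on
  the chart rests on the symmetry of second derivatives, which removes every term that involves more
  than the differential of the chart. In the correspondence no differential equation is solved: each
  curve produces its partner by lifting or projecting and by a change of parameter with rate n, 1/n,
  2n^2 or 1/(2n^2). Constants of integration are the only freedom left, whence uniqueness up to a
  shift.\<close>

lemma frechet_derivative_eqI: "(f has_derivative f') (at x) \<Longrightarrow> frechet_derivative f (at x) = f'"
  using frechet_derivative_at by metis

text \<open>The choice operator behind \<open>frechet_derivative\<close> sees only the predicate
  \<open>has_derivative\<close>, so the equality holds even at points where neither function is
  differentiable.\<close>

lemma frechet_derivative_cong_open:
  assumes "open S" "x \<in> S" "\<And>y. y \<in> S \<Longrightarrow> f y = g y"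
  shows "frechet_derivative f (at x) = frechet_derivative g (at x)"
proof -
  have "(f has_derivative D) (at x) = (g has_derivative D) (at x)" for D
    using has_derivative_transform_within_open[OF _ assms(1,2)] assms(3) by metis
  then show ?thesis
    by (simp add: frechet_derivative_def)
qed

lemma Ck_on_cong:
  assumes S: "open S" and eq: "\<And>x. x \<in> S \<Longrightarrow> f x = g x"
  shows "Ck_on k S f = Ck_on k S g"
  using eq
proof (induction k arbitrary: f g)
  case 0
  then show ?case by simp
next
  case (Suc k)
  have "f differentiable at x \<longleftrightarrow> g differentiable at x" if "x \<in> S" for x
    using has_derivative_transform_within_open[OF _ S that] Suc.prems
    unfolding differentiable_def by metis
  moreover have "Ck_on k S (\<lambda>x. frechet_derivative f (at x) v)
      = Ck_on k S (\<lambda>x. frechet_derivative g (at x) v)" for v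
    by (rule Suc.IH) (simp add: frechet_derivative_cong_open[OF S _ Suc.prems])
  ultimately show ?case by auto
qed

text \<open>Trades the chosen derivative for an explicit formula, so that each closure property
  below becomes a differentiation rule plus induction on the order.\<close>

lemma Ck_on_SucI:
  assumes "open S" "\<And>x. x \<in> S \<Longrightarrow> (f has_derivative f' x) (at x)"
    "\<And>v. Ck_on k S (\<lambda>x. f' x v)"
  shows "Ck_on (Suc k) S f"
proof -
  have "Ck_on k S (\<lambda>x. frechet_derivative f (at x) v)" for v
    using assms(3)[of v] frechet_derivative_eqI[OF assms(2)]
    by (subst Ck_on_cong[where g = "\<lambda>x. f' x v"]) (auto simp: assms(1))
  then show ?thesis
    using assms(2) by (auto simp: differentiable_def)
qed

lemma Ck_on_SucD:
  assumes "Ck_on (Suc k) S f"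
  shows Ck_on_imp_has_derivative:
      "x \<in> S \<Longrightarrow> (f has_derivative frechet_derivative f (at x)) (at x)"
    and Ck_on_frechet_derivative: "Ck_on k S (\<lambda>x. frechet_derivative f (at x) v)"
  using assms frechet_derivative_works by auto

text \<open>Needed by the product and chain rules, where a derivative of order \<open>k\<close>
  stands next to an undifferentiated factor of order \<open>Suc k\<close>.\<close>

lemma Ck_on_mono: "Ck_on (Suc k) S f \<Longrightarrow> Ck_on k S f"
proof (induction k arbitrary: f)
  case 0
  then show ?case
    by (auto intro!: differentiable_imp_continuous_on differentiable_at_imp_differentiable_on)
next
  case (Suc k)
  then show ?case
    by (metis Ck_on.simps(2))
qed

lemma Ck_on_subset: "Ck_on k S f \<Longrightarrow> T \<subseteq> S \<Longrightarrow> Ck_on k T f"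
  by (induction k arbitrary: f) (auto intro: continuous_on_subset)

lemma Ck_on_const: "open S \<Longrightarrow> Ck_on k S (\<lambda>x. c)"
proof (induction k arbitrary: c)
  case (Suc k)
  then show ?case
    by (intro Ck_on_SucI[where f' = "\<lambda>_ _. 0"]) auto
qed auto

lemma Ck_on_bounded_linear:
  assumes "open S" "bounded_linear L"
  shows "Ck_on k S L"
proof (cases k)
  case 0
  then show ?thesis
    using assms bounded_linear.continuous_on[OF _ continuous_on_id] by auto
next
  case (Suc j)
  then show ?thesis
    unfolding Suc
    by (intro Ck_on_SucI[OF assms(1), where f' = "\<lambda>_. L"] Ck_on_const assms
        bounded_linear_imp_has_derivative)
qed

lemma Ck_on_bounded_linear_compose:
  assumes "open S" "bounded_linear L" "Ck_on k S f"
  shows "Ck_on k S (\<lambda>x. L (f x))"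
  using assms(3)
proof (induction k arbitrary: f)
  case 0
  then show ?case
    using bounded_linear.continuous_on[OF assms(2)] by auto
next
  case (Suc k)
  note f = Ck_on_SucD[OF Suc.prems]
  show ?case
    by (rule Ck_on_SucI[OF assms(1) bounded_linear.has_derivative[OF assms(2) f(1)]
          Suc.IH[OF f(2)]])
qed

lemma Ck_on_add:
  assumes "open S" "Ck_on k S f" "Ck_on k S g"
  shows "Ck_on k S (\<lambda>x. f x + g x)"
  using assms(2,3)
proof (induction k arbitrary: f g)
  case 0
  then show ?case by (auto intro: continuous_on_add)
next
  case (Suc k)
  note f = Ck_on_SucD[OF Suc.prems(1)] and g = Ck_on_SucD[OF Suc.prems(2)]
  show ?case
    by (rule Ck_on_SucI[OF assms(1) has_derivative_add[OF f(1) g(1)] Suc.IH[OF f(2) g(2)]])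
qed

lemma Ck_on_sum:
  assumes "open S" "\<And>i. i \<in> A \<Longrightarrow> Ck_on k S (f i)"
  shows "Ck_on k S (\<lambda>x. \<Sum>i\<in>A. f i x)"
  using assms(2)
  by (induction A rule: infinite_finite_induct) (auto simp: Ck_on_const Ck_on_add assms(1))

lemma Ck_on_bilinear:
  assumes "open S" "bounded_bilinear bop" "Ck_on k S f" "Ck_on k S g"
  shows "Ck_on k S (\<lambda>x. bop (f x) (g x))"
  using assms(3,4)
proof (induction k arbitrary: f g)
  case 0
  then show ?case
    by (auto intro: bounded_bilinear.continuous_on[OF assms(2)])
next
  case (Suc k)
  note f = Ck_on_SucD[OF Suc.prems(1)] and g = Ck_on_SucD[OF Suc.prems(2)]
  show ?case
    by (rule Ck_on_SucI[OF assms(1) bounded_bilinear.FDERIV[OF assms(2) f(1) g(1)]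
        Ck_on_add[OF assms(1) Suc.IH[OF Ck_on_mono[OF Suc.prems(1)] g(2)]
          Suc.IH[OF f(2) Ck_on_mono[OF Suc.prems(2)]]]])
qed

lemma Ck_on_inverse:
  fixes f :: "'a::euclidean_space \<Rightarrow> real"
  assumes "open S" "Ck_on k S f" "\<And>x. x \<in> S \<Longrightarrow> f x \<noteq> 0"
  shows "Ck_on k S (\<lambda>x. inverse (f x))"
  using assms(2)
proof (induction k)
  case 0
  then show ?case
    using assms(3) by (auto intro: continuous_on_inverse)
next
  case (Suc k)
  note f = Ck_on_SucD[OF Suc.prems]
  note I = Suc.IH[OF Ck_on_mono[OF Suc.prems]]
  \<comment> \<open>The sign is written as a constant factor so that the bilinear rule covers the
    whole expression.\<close>
  have "Ck_on k S (\<lambda>x. - 1 * (inverse (f x) * frechet_derivative f (at x) v * inverse (f x)))" for v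
    by (intro Ck_on_bilinear[OF assms(1) bounded_bilinear_mult] I f(2) Ck_on_const[OF assms(1)])
  then show ?case
    by (intro Ck_on_SucI[OF assms(1) Deriv.has_derivative_inverse[OF assms(3) f(1)]]) auto
qed

lemma Ck_on_compose:
  fixes f :: "'a::euclidean_space \<Rightarrow> 'b::euclidean_space" and g :: "'b \<Rightarrow> 'c::real_normed_vector"
  assumes "open S" "open T" "f ` S \<subseteq> T" "Ck_on k S f" "Ck_on k T g"
  shows "Ck_on k S (\<lambda>x. g (f x))"
  using assms(4,5)
proof (induction k arbitrary: g)
  case 0
  then show ?case
    using continuous_on_compose2[OF _ _ assms(3)] by simp
next
  case (Suc k)
  note f = Ck_on_SucD[OF Suc.prems(1)] and g = Ck_on_SucD[OF Suc.prems(2)]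
  \<comment> \<open>In the chain rule both the base point \<open>f x\<close> and the direction
    depend on \<open>x\<close>, but the induction hypothesis handles only derivatives in a fixed
    direction. Expanding the direction in the basis separates the two dependences.\<close>
  let ?D = "\<lambda>x v. \<Sum>b\<in>Basis.
    (frechet_derivative f (at x) v \<bullet> b) *\<^sub>R frechet_derivative g (at (f x)) b"
  have "((\<lambda>x. g (f x)) has_derivative ?D x) (at x)" if x: "x \<in> S" for x
  proof -
    have fx: "f x \<in> T" using assms(3) x by blast
    have l: "linear (frechet_derivative g (at (f x)))"
      using g(1)[OF fx] has_derivative_linear by blast
    have "((\<lambda>x. g (f x)) has_derivative
        (\<lambda>v. frechet_derivative g (at (f x)) (frechet_derivative f (at x) v))) (at x)"
      using has_derivative_compose[OF f(1)[OF x] g(1)[OF fx]] .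
    moreover have "frechet_derivative g (at (f x)) w
        = (\<Sum>b\<in>Basis. (w \<bullet> b) *\<^sub>R frechet_derivative g (at (f x)) b)" for w
      using linear_sum[OF l, of "\<lambda>b. (w \<bullet> b) *\<^sub>R b" Basis]
      by (simp add: euclidean_representation linear_scale[OF l])
    then have "(\<lambda>v. frechet_derivative g (at (f x)) (frechet_derivative f (at x) v)) = ?D x"
      by (rule ext)
    ultimately show ?thesis by (rule has_derivative_eq_rhs)
  qed
  moreover have "Ck_on k S (\<lambda>x. ?D x v)" for v
    by (intro Ck_on_sum[OF assms(1)] Ck_on_bilinear[OF assms(1) bounded_bilinear_scaleR]
        Ck_on_bounded_linear_compose[OF assms(1) bounded_linear_inner_left]
        f(2) Suc.IH[OF Ck_on_mono[OF Suc.prems(1)] g(2)])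
  ultimately show ?case
    by (rule Ck_on_SucI[OF assms(1)])
qed

lemma smooth_on_has_derivative:
  "smooth_on S f \<Longrightarrow> x \<in> S \<Longrightarrow> (f has_derivative frechet_derivative f (at x)) (at x)"
  unfolding smooth_on_def using Ck_on_imp_has_derivative by blast

lemma smooth_on_imp_continuous_on: "smooth_on S f \<Longrightarrow> continuous_on S f"
  unfolding smooth_on_def using Ck_on.simps(1) by blast

lemma smooth_on_frechet_derivative:
  "smooth_on S f \<Longrightarrow> smooth_on S (\<lambda>x. frechet_derivative f (at x) v)"
  unfolding smooth_on_def using Ck_on_frechet_derivative by blast

lemma smooth_on_subset: "smooth_on S f \<Longrightarrow> T \<subseteq> S \<Longrightarrow> smooth_on T f"
  unfolding smooth_on_def using Ck_on_subset by blast

lemma smooth_on_cong: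
  "open S \<Longrightarrow> (\<And>x. x \<in> S \<Longrightarrow> f x = g x) \<Longrightarrow> smooth_on S f = smooth_on S g"
  unfolding smooth_on_def using Ck_on_cong[of S f g] by blast

lemma smooth_on_const: "open S \<Longrightarrow> smooth_on S (\<lambda>x. c)"
  unfolding smooth_on_def using Ck_on_const by blast

lemma smooth_on_linear: "open S \<Longrightarrow> bounded_linear L \<Longrightarrow> smooth_on S L"
  unfolding smooth_on_def using Ck_on_bounded_linear by blast

lemma smooth_on_linear_compose:
  "open S \<Longrightarrow> bounded_linear L \<Longrightarrow> smooth_on S f \<Longrightarrow> smooth_on S (\<lambda>x. L (f x))"
  unfolding smooth_on_def using Ck_on_bounded_linear_compose[of S L _ f] by blast

lemma smooth_on_add:
  "open S \<Longrightarrow> smooth_on S f \<Longrightarrow> smooth_on S g \<Longrightarrow> smooth_on S (\<lambda>x. f x + g x)"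
  unfolding smooth_on_def using Ck_on_add[of S _ f g] by blast

lemma smooth_on_sum:
  "open S \<Longrightarrow> (\<And>i. i \<in> A \<Longrightarrow> smooth_on S (f i)) \<Longrightarrow> smooth_on S (\<lambda>x. \<Sum>i\<in>A. f i x)"
  unfolding smooth_on_def using Ck_on_sum[of S A _ f] by blast

lemma smooth_on_bilinear:
  "open S \<Longrightarrow> bounded_bilinear bop \<Longrightarrow> smooth_on S f \<Longrightarrow> smooth_on S g \<Longrightarrow>
    smooth_on S (\<lambda>x. bop (f x) (g x))"
  unfolding smooth_on_def using Ck_on_bilinear[of S bop _ f g] by blast

lemmas smooth_on_mult = smooth_on_bilinear[OF _ bounded_bilinear_mult]
lemmas smooth_on_scaleR = smooth_on_bilinear[OF _ bounded_bilinear_scaleR]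
lemmas smooth_on_inner = smooth_on_bilinear[OF _ bounded_bilinear_inner]

lemma smooth_on_inverse:
  fixes f :: "'a::euclidean_space \<Rightarrow> real"
  shows "open S \<Longrightarrow> smooth_on S f \<Longrightarrow> (\<And>x. x \<in> S \<Longrightarrow> f x \<noteq> 0) \<Longrightarrow>
    smooth_on S (\<lambda>x. inverse (f x))"
  unfolding smooth_on_def using Ck_on_inverse[of S _ f] by blast

lemma smooth_on_compose:
  fixes f :: "'a::euclidean_space \<Rightarrow> 'b::euclidean_space" and g :: "'b \<Rightarrow> 'c::real_normed_vector"
  shows "open S \<Longrightarrow> open T \<Longrightarrow> f ` S \<subseteq> T \<Longrightarrow> smooth_on S f \<Longrightarrow> smooth_on T g \<Longrightarrow>
    smooth_on S (\<lambda>x. g (f x))"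
  unfolding smooth_on_def using Ck_on_compose[of S T f _ g] by blast

lemma smooth_on_Pair:
  assumes S: "open S" and "smooth_on S f" "smooth_on S g"
  shows "smooth_on S (\<lambda>x. (f x, g x))"
proof -
  have "bounded_linear (\<lambda>x. (x, 0))" "bounded_linear (\<lambda>x. (0, x))"
    by (intro bounded_linear_Pair bounded_linear_ident bounded_linear_zero)+
  then have "smooth_on S (\<lambda>x. (f x, 0) + (0, g x))"
    using assms by (intro smooth_on_add[OF S])
      (rule smooth_on_linear_compose[where L="\<lambda>x. (x, 0)"] smooth_on_linear_compose[where L="\<lambda>x. (0, x)"]; simp)+
  then show ?thesis by simp
qed

text \<open>Both mixed derivatives are limits of the same second difference quotient.\<close>

lemma second_difference_mvt:
  fixes f :: "'a::euclidean_space \<Rightarrow> real"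
  assumes f: "Ck_on 2 S f" and h: "0 < h"
    and S: "\<And>s t. 0 \<le> s \<Longrightarrow> s \<le> h \<Longrightarrow> 0 \<le> t \<Longrightarrow> t \<le> h \<Longrightarrow> u + s *\<^sub>R a + t *\<^sub>R b \<in> S"
  obtains s t where "0 \<le> s" "s \<le> h" "0 \<le> t" "t \<le> h"
    "f (u + h *\<^sub>R a + h *\<^sub>R b) - f (u + h *\<^sub>R a) - f (u + h *\<^sub>R b) + f u
      = h * h * frechet_derivative (\<lambda>y. frechet_derivative f (at y) a)
          (at (u + s *\<^sub>R a + t *\<^sub>R b)) b"
proof -
  have f2: "Ck_on (Suc 1) S f" using f by (simp add: numeral_2_eq_2)
  let ?Df = "\<lambda>y. frechet_derivative f (at y) a"
  have f1: "Ck_on (Suc 0) S ?Df"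
    using Ck_on_frechet_derivative[OF f2] by simp
  \<comment> \<open>The mean value theorem acts on the difference of \<open>f\<close> between two
    parallel edges in direction \<open>a\<close> and yields \<open>s\<close>; a second use, on the
    \<open>a\<close>-derivative along direction \<open>b\<close>, yields \<open>t\<close>. The term
    \<open>0 *\<^sub>R b\<close> is kept so that both edges are instances of one claim.\<close>
  have "((\<lambda>s. f (u + s *\<^sub>R a + h *\<^sub>R b) - f (u + s *\<^sub>R a + 0 *\<^sub>R b)) has_derivative
      (\<lambda>x. frechet_derivative f (at (u + s *\<^sub>R a + h *\<^sub>R b)) (x *\<^sub>R a)
        - frechet_derivative f (at (u + s *\<^sub>R a + 0 *\<^sub>R b)) (x *\<^sub>R a))) (at s)"
    if "0 \<le> s" "s \<le> h" for s
  proof -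
    have "((\<lambda>s. f (u + s *\<^sub>R a + c *\<^sub>R b)) has_derivative
        (\<lambda>x. frechet_derivative f (at (u + s *\<^sub>R a + c *\<^sub>R b)) (x *\<^sub>R a))) (at s)"
      if "c \<in> {0, h}" for c
    proof (rule has_derivative_compose[where f = "\<lambda>s. u + s *\<^sub>R a + c *\<^sub>R b"])
      show "((\<lambda>s. u + s *\<^sub>R a + c *\<^sub>R b) has_derivative (\<lambda>x. x *\<^sub>R a)) (at s)"
        by (auto intro!: derivative_eq_intros)
      show "(f has_derivative frechet_derivative f (at (u + s *\<^sub>R a + c *\<^sub>R b)))
          (at (u + s *\<^sub>R a + c *\<^sub>R b))"
        using \<open>0 \<le> s\<close> \<open>s \<le> h\<close> that h by (intro Ck_on_imp_has_derivative[OF f2] S) auto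
    qed
    then show ?thesis
      by (intro has_derivative_diff) blast+
  qed
  then obtain s where s: "0 < s" "s < h" and
    "(f (u + h *\<^sub>R a + h *\<^sub>R b) - f (u + h *\<^sub>R a + 0 *\<^sub>R b))
      - (f (u + 0 *\<^sub>R a + h *\<^sub>R b) - f (u + 0 *\<^sub>R a + 0 *\<^sub>R b))
      = frechet_derivative f (at (u + s *\<^sub>R a + h *\<^sub>R b)) ((h - 0) *\<^sub>R a)
        - frechet_derivative f (at (u + s *\<^sub>R a + 0 *\<^sub>R b)) ((h - 0) *\<^sub>R a)"
    using mvt_simple[OF h has_derivative_at_withinI] by (smt (verit) greaterThanLessThan_iff)
  moreover have "frechet_derivative f (at y) (c *\<^sub>R a) = c * ?Df y" if "y \<in> S" for y c
    using linear_scale[OF has_derivative_linear[OF Ck_on_imp_has_derivative[OF f2 that]]] by simp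
  ultimately have 1: "f (u + h *\<^sub>R a + h *\<^sub>R b) - f (u + h *\<^sub>R a) - f (u + h *\<^sub>R b) + f u
      = h * (?Df (u + s *\<^sub>R a + h *\<^sub>R b) - ?Df (u + s *\<^sub>R a + 0 *\<^sub>R b))"
    using S[of s h] S[of s 0] h by (simp add: algebra_simps)
  have "((\<lambda>t. ?Df (u + s *\<^sub>R a + t *\<^sub>R b)) has_derivative
      (\<lambda>x. frechet_derivative ?Df (at (u + s *\<^sub>R a + t *\<^sub>R b)) (x *\<^sub>R b))) (at t)"
    if "0 \<le> t" "t \<le> h" for t
  proof (rule has_derivative_compose[where f = "\<lambda>t. u + s *\<^sub>R a + t *\<^sub>R b"])
    show "((\<lambda>t. u + s *\<^sub>R a + t *\<^sub>R b) has_derivative (\<lambda>x. x *\<^sub>R b)) (at t)"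
      by (auto intro!: derivative_eq_intros)
    show "(?Df has_derivative frechet_derivative ?Df (at (u + s *\<^sub>R a + t *\<^sub>R b)))
        (at (u + s *\<^sub>R a + t *\<^sub>R b))"
      using that s by (intro Ck_on_imp_has_derivative[OF f1] S) auto
  qed
  then obtain t where t: "0 < t" "t < h" and
    "?Df (u + s *\<^sub>R a + h *\<^sub>R b) - ?Df (u + s *\<^sub>R a + 0 *\<^sub>R b)
      = frechet_derivative ?Df (at (u + s *\<^sub>R a + t *\<^sub>R b)) ((h - 0) *\<^sub>R b)"
    using mvt_simple[OF h has_derivative_at_withinI] by (smt (verit) greaterThanLessThan_iff)
  moreover have "frechet_derivative ?Df (at y) (c *\<^sub>R b) = c * frechet_derivative ?Df (at y) b"
    if "y \<in> S" for y c
    using linear_scale[OF has_derivative_linear[OF Ck_on_imp_has_derivative[OF f1 that]]] by simp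
  ultimately have "f (u + h *\<^sub>R a + h *\<^sub>R b) - f (u + h *\<^sub>R a) - f (u + h *\<^sub>R b) + f u
      = h * h * frechet_derivative ?Df (at (u + s *\<^sub>R a + t *\<^sub>R b)) b"
    using S[of s t] s 1 by simp
  then show thesis
    using that[of s t] s t by simp
qed

text \<open>The second difference over the parallelogram spanned by \<open>h *\<^sub>R a\<close> and
  \<open>h *\<^sub>R b\<close> is symmetric in \<open>a\<close> and \<open>b\<close>, hence a value
  of either mixed derivative at a nearby point. If the two differed at \<open>u\<close>, continuity
  would keep these values apart.\<close>

lemma mixed_derivatives_commute_real:
  fixes f :: "'a::euclidean_space \<Rightarrow> real"
  assumes S: "open S" and f: "Ck_on 2 S f" and u: "u \<in> S"
  shows "frechet_derivative (\<lambda>y. frechet_derivative f (at y) a) (at u) b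
    = frechet_derivative (\<lambda>y. frechet_derivative f (at y) b) (at u) a"
proof (rule ccontr)
  let ?G = "\<lambda>a b x. frechet_derivative (\<lambda>y. frechet_derivative f (at y) a) (at x) b"
  \<comment> \<open>Half the gap: two equal numbers, each closer than \<open>e\<close> to one of the
    two derivatives, contradict the triangle inequality.\<close>
  define e where "e = \<bar>?G a b u - ?G b a u\<bar> / 2"
  assume "?G a b u \<noteq> ?G b a u"
  then have e: "e > 0" by (simp add: e_def)
  have "Ck_on (Suc 0) S (\<lambda>y. frechet_derivative f (at y) a)" for a
    using f by (simp add: numeral_2_eq_2)
  then have "continuous_on S (?G a b)" for a b
    using Ck_on_frechet_derivative by fastforce
  then have "\<exists>d>0. \<forall>x. dist x u < d \<longrightarrow> x \<in> S \<and> dist (?G a b x) (?G a b u) < e" for a b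
    using S u e unfolding continuous_on_eq_continuous_at[OF S] continuous_at_eps_delta open_dist
    by (metis (no_types, lifting) min_less_iff_conj)
  then obtain d d' where d: "d > 0" "\<And>x. dist x u < d \<Longrightarrow> x \<in> S \<and> dist (?G a b x) (?G a b u) < e"
    and d': "d' > 0" "\<And>x. dist x u < d' \<Longrightarrow> x \<in> S \<and> dist (?G b a x) (?G b a u) < e"
    by meson
  \<comment> \<open>Puts the whole parallelogram within both radii; the summand 1 keeps the
    denominator positive when \<open>a\<close> and \<open>b\<close> vanish.\<close>
  define h where "h = min d d' / (norm a + norm b + 1)"
  have pos: "norm a + norm b + 1 > 0" by (smt (verit) norm_ge_zero)
  have h: "h > 0" using d d' pos by (simp add: h_def)
  have near: "dist (u + s *\<^sub>R a + t *\<^sub>R b) u < min d d'"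
    if "0 \<le> s" "s \<le> h" "0 \<le> t" "t \<le> h" for s t
  proof -
    have "dist (u + s *\<^sub>R a + t *\<^sub>R b) u \<le> s * norm a + t * norm b"
      using that norm_triangle_ineq[of "s *\<^sub>R a" "t *\<^sub>R b"] by (simp add: dist_norm algebra_simps)
    also have "\<dots> \<le> h * norm a + h * norm b"
      using that by (intro add_mono mult_right_mono) auto
    also have "\<dots> < h * (norm a + norm b + 1)"
      using h by (simp add: algebra_simps)
    also have "\<dots> = min d d'"
      using pos by (simp add: h_def)
    finally show ?thesis .
  qed
  have near': "dist (u + s *\<^sub>R b + t *\<^sub>R a) u < min d d'"
    if "0 \<le> s" "s \<le> h" "0 \<le> t" "t \<le> h" for s t
    using near[of t s] that by (simp add: ac_simps)
  obtain s t where st: "0 \<le> s" "s \<le> h" "0 \<le> t" "t \<le> h"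
    "f (u + h *\<^sub>R a + h *\<^sub>R b) - f (u + h *\<^sub>R a) - f (u + h *\<^sub>R b) + f u
      = h * h * ?G a b (u + s *\<^sub>R a + t *\<^sub>R b)"
    using second_difference_mvt[OF f h, of u a b] near d(2) by (metis min_less_iff_conj)
  obtain s' t' where st': "0 \<le> s'" "s' \<le> h" "0 \<le> t'" "t' \<le> h"
    "f (u + h *\<^sub>R b + h *\<^sub>R a) - f (u + h *\<^sub>R b) - f (u + h *\<^sub>R a) + f u
      = h * h * ?G b a (u + s' *\<^sub>R b + t' *\<^sub>R a)"
    using second_difference_mvt[OF f h, of u b a] near' d(2) by (metis min_less_iff_conj)
  have "u + h *\<^sub>R b + h *\<^sub>R a = u + h *\<^sub>R a + h *\<^sub>R b"
    by simp
  then have "h * h * ?G a b (u + s *\<^sub>R a + t *\<^sub>R b)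
      = h * h * ?G b a (u + s' *\<^sub>R b + t' *\<^sub>R a)"
    using st(5) st'(5) by (smt (verit))
  then have "?G a b (u + s *\<^sub>R a + t *\<^sub>R b) = ?G b a (u + s' *\<^sub>R b + t' *\<^sub>R a)"
    using h by simp
  moreover have "dist (?G a b (u + s *\<^sub>R a + t *\<^sub>R b)) (?G a b u) < e"
    using d(2) near[OF st(1-4)] by simp
  moreover have "dist (?G b a (u + s' *\<^sub>R b + t' *\<^sub>R a)) (?G b a u) < e"
    using d'(2) near'[OF st'(1-4)] by simp
  ultimately show False
    using dist_triangle3[of "?G a b u" "?G b a u" "?G a b (u + s *\<^sub>R a + t *\<^sub>R b)"]
    by (simp add: e_def dist_real_def)
qed

lemma frechet_derivative_inner_left:
  assumes "f differentiable (at x)"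
  shows "frechet_derivative (\<lambda>x. f x \<bullet> c) (at x) v = frechet_derivative f (at x) v \<bullet> c"
proof -
  have "(f has_derivative frechet_derivative f (at x)) (at x)"
    using assms frechet_derivative_works by blast
  then have "((\<lambda>x. f x \<bullet> c) has_derivative (\<lambda>h. frechet_derivative f (at x) h \<bullet> c)) (at x)"
    by (rule has_derivative_inner_left)
  from frechet_derivative_eqI[OF this] show ?thesis
    by (rule fun_cong)
qed

text \<open>Pairing with a fixed basis vector commutes with both differentiations and reduces the
  claim to real functions.\<close>

lemma mixed_derivatives_commute:
  fixes f :: "'a::euclidean_space \<Rightarrow> 'b::euclidean_space"
  assumes S: "open S" and f: "smooth_on S f" and u: "u \<in> S"
  shows "frechet_derivative (\<lambda>y. frechet_derivative f (at y) a) (at u) b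
    = frechet_derivative (\<lambda>y. frechet_derivative f (at y) b) (at u) a"
proof (rule euclidean_eqI)
  fix c :: 'b
  let ?f = "\<lambda>y. f y \<bullet> c"
  have "frechet_derivative (\<lambda>y. frechet_derivative f (at y) a) (at u) b \<bullet> c
    = frechet_derivative (\<lambda>y. frechet_derivative ?f (at y) a) (at u) b" for a b
  proof -
    have "frechet_derivative ?f (at y) a = frechet_derivative f (at y) a \<bullet> c" if "y \<in> S" for y
      using smooth_on_has_derivative[OF f that]
      by (intro frechet_derivative_inner_left) (auto simp: differentiable_def)
    then have "frechet_derivative (\<lambda>y. frechet_derivative ?f (at y) a) (at u) b
        = frechet_derivative (\<lambda>y. frechet_derivative f (at y) a \<bullet> c) (at u) b"
      by (intro fun_cong[OF frechet_derivative_cong_open[OF S u]])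
    also have "\<dots> = frechet_derivative (\<lambda>y. frechet_derivative f (at y) a) (at u) b \<bullet> c"
      using smooth_on_has_derivative[OF smooth_on_frechet_derivative[OF f] u]
      by (intro frechet_derivative_inner_left) (auto simp: differentiable_def)
    finally show ?thesis by simp
  qed
  moreover have "Ck_on 2 S ?f"
    using smooth_on_linear_compose[OF S bounded_linear_inner_left f] by (simp add: smooth_on_def)
  ultimately show "frechet_derivative (\<lambda>y. frechet_derivative f (at y) a) (at u) b \<bullet> c
      = frechet_derivative (\<lambda>y. frechet_derivative f (at y) b) (at u) a \<bullet> c"
    using mixed_derivatives_commute_real[OF S _ u] by simp
qed

section \<open>Gradients\<close>

lemma grad_eqI:
  assumes "GDERIV f x :> D"
  shows "grad f x = D"
  unfolding grad_def
proof (rule the_equality[where P = "\<lambda>D. GDERIV f x :> D"])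
  fix E assume "GDERIV f x :> E"
  then have "(\<lambda>h. h \<bullet> E) = (\<lambda>h. h \<bullet> D)"
    using assms unfolding gderiv_def by (rule has_derivative_unique)
  then show "E = D"
    by (metis inner_commute vector_eq_ldot)
qed (fact assms)

text \<open>The representing vector of the differential in coordinates. The second equation lets
  smoothness of the gradient follow from that of the directional derivatives.\<close>

lemma has_derivative_grad:
  fixes f :: "'a::euclidean_space \<Rightarrow> real"
  assumes "f differentiable (at x)"
  shows "(f has_derivative (\<lambda>h. h \<bullet> grad f x)) (at x)"
    and "grad f x = (\<Sum>b\<in>Basis. frechet_derivative f (at x) b *\<^sub>R b)"
proof -
  let ?D = "\<Sum>b\<in>Basis. frechet_derivative f (at x) b *\<^sub>R b"
  have d: "(f has_derivative frechet_derivative f (at x)) (at x)"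
    using assms frechet_derivative_works by blast
  then have l: "linear (frechet_derivative f (at x))" by (rule has_derivative_linear)
  have "frechet_derivative f (at x) h = h \<bullet> ?D" for h
    using linear_sum[OF l, of "\<lambda>b. (h \<bullet> b) *\<^sub>R b" Basis]
    by (simp add: euclidean_representation linear_scale[OF l] inner_sum_right mult.commute)
  then have "frechet_derivative f (at x) = (\<lambda>h. h \<bullet> ?D)" by (rule ext)
  then have "GDERIV f x :> ?D" using d by (simp add: gderiv_def)
  then show "grad f x = ?D" "(f has_derivative (\<lambda>h. h \<bullet> grad f x)) (at x)"
    using grad_eqI gderiv_def by fastforce+
qed

section \<open>Wedge products in low degree\<close>

text \<open>Twice the Pfaffian of the matrix \<open>w\<close>: each of the three pairings of four
  indices arises from 8 of the 24 permutations, and \<open>fact 2 * fact 2\<close> divides by 4. The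
  form \<open>b\<close> is constrained only on selections from \<open>v\<close>, because d\<alpha>
  will be known only on tangent vectors.\<close>

lemma wedge_2_2:
  assumes b: "\<And>f. f 0 < 4 \<Longrightarrow> f 1 < 4 \<Longrightarrow> b (\<lambda>i. v (f i)) = w (f 0) (f 1)"
    and w: "\<And>i j. w i j = - w j i"
  shows "wedge 2 2 b b v = 2 * (w 0 1 * w 2 3 - w 0 2 * w 1 3 + w 0 3 * w (1::nat) 2)"
proof -
  \<comment> \<open>Side conditions for enumerating the permutations by splitting off the least
    element repeatedly.\<close>
  have f: "finite {1, 2, 3::nat}" "0 \<notin> {1, 2, 3::nat}" "finite {2, 3::nat}" "1 \<notin> {2, 3::nat}"
    "finite {3::nat}" "2 \<notin> {3::nat}"
    by auto
  have 4: "{..<4} = {0, 1, 2, 3::nat}" by auto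
  have b': "b (\<lambda>i. v (\<sigma> i)) = w (\<sigma> 0) (\<sigma> 1)" "b (\<lambda>i. v (\<sigma> (2 + i))) = w (\<sigma> 2) (\<sigma> 3)"
    if "\<sigma> permutes {..<4}" for \<sigma>
    using b[of \<sigma>] b[of "\<lambda>i. \<sigma> (2 + i)"] permutes_in_image[OF that] by (auto simp: numeral_3_eq_3)
  have anti: "w 1 0 = - w 0 1" "w 2 0 = - w 0 2" "w 3 0 = - w 0 3" "w 2 1 = - w 1 2"
    "w 3 1 = - w 1 3" "w 3 2 = - w 2 3"
    by (rule w)+
  have "wedge 2 2 b b v = (\<Sum>\<sigma> | \<sigma> permutes {..<4}.
     of_int (sign \<sigma>) * w (\<sigma> 0) (\<sigma> 1) * w (\<sigma> 2) (\<sigma> 3)) / 4"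
    unfolding wedge_def by (simp add: b' fact_numeral del: add_2_eq_Suc)
  also have "\<dots> = 2 * (w 0 1 * w 2 3 - w 0 2 * w 1 3 + w 0 3 * w 1 2)"
    unfolding 4 sum_over_permutations_insert[OF f(1,2)] sum_over_permutations_insert[OF f(3,4)]
      sum_over_permutations_insert[OF f(5,6)] permutes_sing
    by (simp add: sign_swap_id permutation_swap_id permutation_compose sign_compose sign_id
        swap_id_eq anti[unfolded One_nat_def])
  finally show ?thesis .
qed

text \<open>Adapted to a basis whose vectors \<open>v 1\<close> to \<open>v 4\<close> lie in the
  kernel of \<open>a\<close>: only permutations that fix 0 contribute, and what remains is the
  Pfaffian of \<open>w\<close> on the other four.\<close>

lemma wedge_1_4_wedge_2_2:
  assumes a: "\<And>f. f 0 < 5 \<Longrightarrow> a (\<lambda>i. v (f i)) = (if f 0 = 0 then c else 0)"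
    and b: "\<And>f. f 0 < 5 \<Longrightarrow> f 1 < 5 \<Longrightarrow> b (\<lambda>i. v (f i)) = w (f 0) (f 1)"
    and w: "\<And>i j. w i j = - w j i"
  shows "wedge 1 4 a (wedge 2 2 b b) v
    = 2 * c * (w 1 2 * w 3 4 - w 1 3 * w 2 4 + w 1 4 * w (2::nat) 3)"
proof -
  have f: "finite {1, 2, 3, 4::nat}" "0 \<notin> {1, 2, 3, 4::nat}" "finite {2, 3, 4::nat}" "1 \<notin> {2, 3, 4::nat}"
    "finite {3, 4::nat}" "2 \<notin> {3, 4::nat}" "finite {4::nat}" "3 \<notin> {4::nat}"
    by auto
  have 5: "{..<5} = {0, 1, 2, 3, 4::nat}" by auto
  define B where "B \<sigma> = 2 * (w (\<sigma> 1) (\<sigma> 2) * w (\<sigma> 3) (\<sigma> 4) - w (\<sigma> 1) (\<sigma> 3) * w (\<sigma> 2) (\<sigma> 4)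
    + w (\<sigma> 1) (\<sigma> 4) * w (\<sigma> 2) (\<sigma> 3))" for \<sigma> :: "nat \<Rightarrow> nat"
  have "wedge 2 2 b b (\<lambda>i. v (\<sigma> (1 + i))) = B \<sigma>" if "\<sigma> permutes {..<5}" for \<sigma>
  proof -
    have "f i < 4 \<Longrightarrow> \<sigma> (1 + f i) < 5" for f :: "nat \<Rightarrow> nat" and i
      using permutes_in_image[OF that, of "1 + f i"] by auto
    then have "wedge 2 2 b b (\<lambda>i. v (\<sigma> (1 + i))) = 2 * (w (\<sigma> (1 + 0)) (\<sigma> (1 + 1)) * w (\<sigma> (1 + 2)) (\<sigma> (1 + 3))
        - w (\<sigma> (1 + 0)) (\<sigma> (1 + 2)) * w (\<sigma> (1 + 1)) (\<sigma> (1 + 3))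
        + w (\<sigma> (1 + 0)) (\<sigma> (1 + 3)) * w (\<sigma> (1 + 1)) (\<sigma> (1 + 2)))"
      by (intro wedge_2_2[where w = "\<lambda>i j. w (\<sigma> (1 + i)) (\<sigma> (1 + j))"] w b) auto
    moreover have "1 + 0 = (1::nat)" "1 + 1 = (2::nat)" "1 + 2 = (3::nat)" "1 + 3 = (4::nat)"
      by simp_all
    ultimately show ?thesis by (simp only: B_def)
  qed
  moreover have "a (\<lambda>i. v (\<sigma> i)) = (if \<sigma> 0 = 0 then c else 0)" if "\<sigma> permutes {..<5}" for \<sigma>
    using a[of \<sigma>] permutes_in_image[OF that, of 0] by auto
  ultimately have "wedge 1 4 a (wedge 2 2 b b) v = (\<Sum>\<sigma> | \<sigma> permutes {..<5}.
     of_int (sign \<sigma>) * (if \<sigma> 0 = 0 then c else 0) * B \<sigma>) / 24"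
    unfolding wedge_def[of 1 4] by (simp add: fact_numeral)
  also have "(\<Sum>\<sigma> | \<sigma> permutes {..<5}. of_int (sign \<sigma>) * (if \<sigma> 0 = 0 then c else 0) * B \<sigma>)
    = (\<Sum>\<sigma> | \<sigma> permutes {1, 2, 3, 4::nat}. of_int (sign \<sigma>) * c * B \<sigma>)"
  proof -
    have h: "\<sigma> 0 = 0" if "\<sigma> permutes {1, 2, 3, 4::nat}" for \<sigma>
      using permutes_not_in[OF that] by simp
    show ?thesis
      unfolding 5 sum_over_permutations_insert[OF f(1,2)]
      by (simp add: h[unfolded One_nat_def] swap_id_eq cong: sum.cong_simp)
  qed
  \<comment> \<open>The sign of each of the 24 permutations is absorbed by the antisymmetry of
    \<open>B\<close>, so each contributes \<open>c\<close> times twice the Pfaffian; the factor 24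
    cancels against \<open>fact 4\<close>.\<close>
  also have "\<dots> = 48 * c * (w 1 2 * w 3 4 - w 1 3 * w 2 4 + w 1 4 * w 2 3)"
  proof -
    have anti: "w 2 1 = - w 1 2" "w 3 1 = - w 1 3" "w 4 1 = - w 1 4" "w 3 2 = - w 2 3"
      "w 4 2 = - w 2 4" "w 4 3 = - w 3 4"
      by (rule w)+
    show ?thesis
    unfolding sum_over_permutations_insert[OF f(3,4)]
      sum_over_permutations_insert[OF f(5,6)] sum_over_permutations_insert[OF f(7,8)] permutes_sing
    by (simp add: sign_swap_id permutation_swap_id permutation_compose sign_compose sign_id
        swap_id_eq B_def anti[unfolded One_nat_def] algebra_simps)
  qed
  finally show ?thesis by simp
qed

lemma wedge_1_1:
  "wedge 1 1 (\<lambda>v. f (v 0)) (\<lambda>v. g (v 0)) v = f (v 0) * g (v 1) - f (v 1) * g (v 0)"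
proof -
  have i: "finite {1::nat}" "0 \<notin> {1::nat}" by auto
  have 2: "{..<1 + 1} = {0, 1::nat}" by auto
  show ?thesis
    unfolding wedge_def 2 sum_over_permutations_insert[OF i] permutes_sing
    by (simp add: sign_swap_id sign_id)
qed

section \<open>Changes of parameter\<close>

lemma has_vector_derivative_real_chain:
  "(\<sigma> has_real_derivative d) (at t) \<Longrightarrow> (g has_vector_derivative g') (at (\<sigma> t)) \<Longrightarrow>
    ((\<lambda>t. g (\<sigma> t)) has_vector_derivative d *\<^sub>R g') (at t)"
  using vector_diff_chain_at[of \<sigma> d t g g']
  by (simp add: o_def has_real_derivative_iff_has_vector_derivative)

lemma open_interval_antiderivative:
  fixes f :: "real \<Rightarrow> real"
  assumes I: "open_interval I" and f: "continuous_on I f"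
  obtains F where "\<And>x. x \<in> I \<Longrightarrow> (F has_real_derivative f x) (at x)"
proof -
  have oI: "open I" and iI: "is_interval I" using I by (auto simp: open_interval_def)
  obtain c where c: "c \<in> I" using I by (auto simp: open_interval_def)
  \<comment> \<open>The integral from \<open>c\<close> to \<open>x\<close> with its sign: an
    integral over an empty or one-point interval is 0, so at most one term is present.\<close>
  let ?F = "\<lambda>x. integral {c..x} f - integral {x..c} f"
  have "(?F has_real_derivative f x) (at x)" if x: "x \<in> I" for x
  proof -
    obtain e e' where e: "e > 0" "cball x e \<subseteq> I" "e' > 0" "cball c e' \<subseteq> I"
      using oI x c by (meson open_contains_cball)
    \<comment> \<open>A compact subinterval of \<open>I\<close> with both \<open>x\<close> and
      \<open>c\<close> in its interior; the fundamental theorem applies there with base point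
      \<open>a\<close>, and moving the base point to \<open>c\<close> changes the antiderivative by
      a constant.\<close>
    define a b where "a = min (x - e) (c - e')" and "b = max (x + e) (c + e')"
    have ab: "a < x" "x < b" "a < c" "c < b"
      using e by (auto simp: a_def b_def)
    have "x - e \<in> I" "x + e \<in> I" "c - e' \<in> I" "c + e' \<in> I"
      using e by (auto simp: subset_iff dist_real_def)
    then have "a \<in> I" "b \<in> I" by (auto simp: a_def b_def min_def max_def)
    then have sub: "{a..b} \<subseteq> I"
      using mem_is_interval_1_I[OF iI] by (meson atLeastAtMost_iff subsetI)
    have cf: "continuous_on {a..b} f" using f sub continuous_on_subset by blast
    have int: "f integrable_on {u..v}" if "a \<le> u" "v \<le> b" for u v
      using that by (intro integrable_continuous_real continuous_on_subset[OF cf]) auto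
    have "((\<lambda>y. integral {a..y} f) has_real_derivative f x) (at x within {a..b})"
      using cf ab by (intro integral_has_real_derivative) auto
    then have "((\<lambda>y. integral {a..y} f) has_real_derivative f x) (at x)"
      using ab by (simp only: at_within_Icc_at)
    then have "((\<lambda>y. integral {a..y} f - integral {a..c} f) has_real_derivative f x) (at x)"
      by (auto intro!: derivative_eq_intros)
    moreover have "integral {a..y} f - integral {a..c} f = ?F y" if "y \<in> {a<..<b}" for y
    proof (cases "c \<le> y")
      case True
      then show ?thesis
        using Henstock_Kurzweil_Integration.integral_combine[of a c y f] int that ab
        by (cases "c = y") auto
    next
      case False
      then show ?thesis
        using Henstock_Kurzweil_Integration.integral_combine[of a y c f] int that ab by auto
    qed
    ultimately show ?thesis
      using has_field_derivative_transform_within_open[of _ "f x" x "{a<..<b}" ?F] ab by auto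
  qed
  then show thesis using that by blast
qed

text \<open>An antiderivative of a positive function is strictly increasing, hence injective; its
  image is open by invariance of domain and an interval by connectedness, and the inverse function
  theorem differentiates the inverse. Every change between arc length, Reeb time and Hamiltonian
  time is an instance.\<close>

lemma time_change:
  fixes f :: "real \<Rightarrow> real"
  assumes I: "open_interval I" and f: "continuous_on I f" and pos: "\<And>s. s \<in> I \<Longrightarrow> f s > 0"
  obtains \<tau> \<sigma> J where "open_interval J" "\<tau> ` I = J" "\<sigma> ` J = I"
    "\<And>s. s \<in> I \<Longrightarrow> (\<tau> has_real_derivative f s) (at s)"
    "\<And>s. s \<in> I \<Longrightarrow> \<sigma> (\<tau> s) = s"
    "\<And>t. t \<in> J \<Longrightarrow> \<sigma> t \<in> I"
    "\<And>t. t \<in> J \<Longrightarrow> \<tau> (\<sigma> t) = t"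
    "\<And>t. t \<in> J \<Longrightarrow> (\<sigma> has_real_derivative inverse (f (\<sigma> t))) (at t)"
proof -
  have oI: "open I" and iI: "is_interval I" and nI: "I \<noteq> {}"
    using I by (auto simp: open_interval_def)
  obtain \<tau> where \<tau>: "\<And>s. s \<in> I \<Longrightarrow> (\<tau> has_real_derivative f s) (at s)"
    using open_interval_antiderivative[OF I f] by blast
  have cont: "continuous_on I \<tau>"
    using \<tau> by (meson DERIV_continuous continuous_at_imp_continuous_on)
  have "\<tau> s < \<tau> t" if "s \<in> I" "t \<in> I" "s < t" for s t
  proof (rule DERIV_pos_imp_increasing[OF \<open>s < t\<close>])
    fix x assume "s \<le> x" "x \<le> t"
    then have "x \<in> I" using mem_is_interval_1_I[OF iI] that by blast
    then show "\<exists>y. DERIV \<tau> x :> y \<and> 0 < y" using \<tau> pos by blast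
  qed
  then have inj: "inj_on \<tau> I"
    by (metis (no_types, lifting) inj_onI less_irrefl not_less_iff_gr_or_eq)
  define \<sigma> where "\<sigma> = inv_into I \<tau>"
  have \<sigma>\<tau>: "\<sigma> (\<tau> s) = s" if "s \<in> I" for s using inj that by (simp add: \<sigma>_def)
  have \<tau>\<sigma>: "\<tau> (\<sigma> t) = t" "\<sigma> t \<in> I" if "t \<in> \<tau> ` I" for t
    using that by (auto simp: \<sigma>_def f_inv_into_f inv_into_into)
  have "open (\<tau> ` I)"
    using invariance_of_domain[OF cont oI inj] .
  moreover have "is_interval (\<tau> ` I)"
    using connected_continuous_image[OF cont] iI by (simp add: is_interval_connected_1)
  ultimately have "open_interval (\<tau> ` I)" using nI by (auto simp: open_interval_def)
  moreover have "(\<sigma> has_real_derivative inverse (f (\<sigma> t))) (at t)" if t: "t \<in> \<tau> ` I" for t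
  proof -
    have "(\<tau> has_derivative (*) (f (\<sigma> t))) (at (\<sigma> t))"
      using \<tau>[OF \<tau>\<sigma>(2)[OF t]] by (simp add: has_field_derivative_def)
    then have "(\<sigma> has_derivative (*) (inverse (f (\<sigma> t)))) (at (\<tau> (\<sigma> t)))"
      using pos[OF \<tau>\<sigma>(2)[OF t]]
      by (intro has_derivative_inverse_strong[OF oI \<tau>\<sigma>(2)[OF t] cont \<sigma>\<tau>]) (auto simp: fun_eq_iff)
    then show ?thesis using \<tau>\<sigma>(1)[OF t] by (simp add: has_field_derivative_def)
  qed
  moreover have "\<sigma> ` \<tau> ` I = I" using \<sigma>\<tau> by (force simp: image_iff)
  ultimately show thesis
    using that[of "\<tau> ` I" \<tau> \<sigma>] \<sigma>\<tau> \<tau>\<sigma> \<tau> by blast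
qed

text \<open>The constant of integration here is the shift in
  \<open>equal_up_to_shift\<close>.\<close>

lemma same_derivative_imp_shift:
  fixes f g :: "real \<Rightarrow> real"
  assumes "open_interval I" "\<And>x. x \<in> I \<Longrightarrow> (f has_real_derivative h x) (at x)"
    "\<And>x. x \<in> I \<Longrightarrow> (g has_real_derivative h x) (at x)"
  obtains c where "\<And>x. x \<in> I \<Longrightarrow> g x = f x + c"
proof -
  have "\<exists>c. \<forall>x\<in>I. g x - f x = c"
  proof (rule has_field_derivative_zero_constant)
    show "convex I" using assms(1) by (simp add: open_interval_def is_interval_convex)
    show "((\<lambda>x. g x - f x) has_real_derivative 0) (at x within I)" if "x \<in> I" for x
      using DERIV_diff[OF assms(3,2)[OF that]] has_field_derivative_at_within by fastforce
  qed
  then show thesis using that by (metis add.commute diff_add_cancel)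
qed

section \<open>The contact structure\<close>

text \<open>A smooth left inverse on an ambient open set gives everything: the chain rule makes the
  differential injective, and restriction to the image gives the continuous inverse.\<close>

lemma local_paramI:
  fixes \<phi> :: "'m::euclidean_space \<Rightarrow> 'a::euclidean_space"
  assumes U: "open U" and W: "open W" and \<phi>: "smooth_on U \<phi>" and \<psi>: "smooth_on W \<psi>"
    and image: "\<phi> ` U = M \<inter> W" and inverse: "\<And>u. u \<in> U \<Longrightarrow> \<psi> (\<phi> u) = u"
  shows "local_param M U \<phi>"
  unfolding local_param_def
proof (intro conjI ballI U \<phi>)
  fix u assume u: "u \<in> U"
  let ?A = "frechet_derivative \<phi> (at u)" and ?B = "frechet_derivative \<psi> (at (\<phi> u))"
  have "\<phi> u \<in> W" using image u by blast
  then have "((\<lambda>x. \<psi> (\<phi> x)) has_derivative (\<lambda>v. ?B (?A v))) (at u)"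
    by (rule has_derivative_compose[OF smooth_on_has_derivative[OF \<phi> u]
          smooth_on_has_derivative[OF \<psi>]])
  then have "((\<lambda>x. x) has_derivative (\<lambda>v. ?B (?A v))) (at u)"
    by (rule has_derivative_transform_within_open[OF _ U u]) (rule inverse)
  then have "(\<lambda>v. ?B (?A v)) = (\<lambda>v. v)"
    using has_derivative_ident has_derivative_unique by blast
  then show "inj ?A" by (metis injI)
next
  show "openin (top_of_set M) (\<phi> ` U)"
    using image W by (simp add: openin_open_Int)
  have "continuous_on (\<phi> ` U) \<psi>"
    using smooth_on_imp_continuous_on[OF \<psi>] image continuous_on_subset by blast
  then have "homeomorphism U (\<phi> ` U) \<phi> \<psi>"
    using smooth_on_imp_continuous_on[OF \<phi>] inverse
    by (auto simp: homeomorphism_def image_image)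
  then show "\<exists>\<psi>. homeomorphism U (\<phi> ` U) \<phi> \<psi>" by blast
qed

lemma local_param_subset: "local_param M U \<phi> \<Longrightarrow> \<phi> ` U \<subseteq> M"
  unfolding local_param_def using openin_imp_subset by blast

text \<open>The required curve in \<open>M\<close> is the image under \<phi> of a short straight
  segment through \<open>u\<close> in direction \<open>a\<close>.\<close>

lemma local_param_tangent:
  assumes \<phi>: "local_param M U \<phi>" and u: "u \<in> U"
  shows "frechet_derivative \<phi> (at u) a \<in> tangent_space M (\<phi> u)"
proof -
  have U: "open U" and sm: "smooth_on U \<phi>" and sub: "\<phi> ` U \<subseteq> M"
    using \<phi> local_param_subset[OF \<phi>] by (auto simp: local_param_def)
  let ?l = "\<lambda>t::real. u + t *\<^sub>R a"
  have "open (?l -` U)"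
    by (intro open_vimage U continuous_intros)
  moreover have "0 \<in> ?l -` U" using u by simp
  ultimately obtain e where e: "e > 0" "ball 0 e \<subseteq> ?l -` U"
    by (meson open_contains_ball)
  then have lU: "?l ` {-e<..<e} \<subseteq> U"
    by (auto simp: subset_iff dist_real_def)
  have "smooth_on {-e<..<e} ?l"
    by (intro smooth_on_add smooth_on_const smooth_on_linear bounded_linear_scaleR_left) auto
  then have "smooth_on {-e<..<e} (\<lambda>t. \<phi> (?l t))"
    by (intro smooth_on_compose[OF _ U lU _ sm]) auto
  moreover have "((\<lambda>t. \<phi> (?l t)) has_vector_derivative frechet_derivative \<phi> (at u) a) (at 0)"
  proof -
    have d: "(\<phi> has_derivative frechet_derivative \<phi> (at u)) (at (?l 0))"
      using smooth_on_has_derivative[OF sm u] by simp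
    have "(?l has_derivative (\<lambda>t. t *\<^sub>R a)) (at 0)"
      by (auto intro!: derivative_eq_intros)
    from has_derivative_compose[OF this d]
    show ?thesis
      using linear_scale[OF has_derivative_linear[OF d]] by (simp add: has_vector_derivative_def)
  qed
  ultimately show ?thesis
    unfolding tangent_space_def using e(1) lU sub
    by (intro CollectI exI[of _ "\<lambda>t. \<phi> (?l t)"] exI[of _ e]) auto
qed

lemma has_derivative_norm_square_snd:
  "((\<lambda>z. (norm (snd z))\<^sup>2) has_derivative (\<lambda>v. 2 * (snd z \<bullet> snd v))) (at z)"
proof -
  have "((\<lambda>z. snd z \<bullet> snd z) has_derivative (\<lambda>v. snd z \<bullet> snd v + snd v \<bullet> snd z)) (at z)"
    by (intro has_derivative_inner has_derivative_snd has_derivative_ident)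
  then show ?thesis
    unfolding power2_norm_eq_inner
    by (rule has_derivative_eq_rhs) (simp add: fun_eq_iff inner_commute)
qed

lemma dq_eq: "dq i z = (\<lambda>v. fst (v 0) $ i)"
proof -
  have "bounded_linear (\<lambda>z::phase. fst z $ i)"
    by (rule bounded_linear_compose[OF bounded_linear_vec_nth bounded_linear_fst])
  then have "frechet_derivative (\<lambda>z::phase. fst z $ i) (at z) = (\<lambda>z. fst z $ i)"
    by (intro frechet_derivative_eqI bounded_linear_imp_has_derivative)
  then show ?thesis by (intro ext) (simp add: dq_def ext_deriv_def)
qed

lemma dp_eq: "dp i z = (\<lambda>v. snd (v 0) $ i)"
proof -
  have "bounded_linear (\<lambda>z::phase. snd z $ i)"
    by (rule bounded_linear_compose[OF bounded_linear_vec_nth bounded_linear_snd])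
  then have "frechet_derivative (\<lambda>z::phase. snd z $ i) (at z) = (\<lambda>z. snd z $ i)"
    by (intro frechet_derivative_eqI bounded_linear_imp_has_derivative)
  then show ?thesis by (intro ext) (simp add: dp_def ext_deriv_def)
qed

lemma liouville_form_eq: "liouville_form z v = snd z \<bullet> fst (v 0)"
  by (simp add: liouville_form_def dq_eq inner_vec_def)

lemma symplectic_form_eq:
  "symplectic_form z v = fst (v 0) \<bullet> snd (v 1) - fst (v 1) \<bullet> snd (v 0)"
proof -
  have "wedge 1 1 (dq i z) (dp i z) v = fst (v 0) $ i * snd (v 1) $ i - fst (v 1) $ i * snd (v 0) $ i" for i
    unfolding dq_eq dp_eq by (rule wedge_1_1)
  then show ?thesis
    by (simp only: symplectic_form_def inner_vec_def sum_subtractf inner_real_def)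
qed

section \<open>The optical hypersurface as a regular level set\<close>

locale optical_medium =
  fixes n :: "real^3 \<Rightarrow> real"
  assumes n_smooth: "smooth_on UNIV n" and n_pos: "\<And>q. n q > 0"
begin

lemma n_nonzero [simp]: "n q \<noteq> 0"
  using n_pos[of q] by simp

lemma n_continuous: "continuous_on S n"
  using smooth_on_imp_continuous_on[OF n_smooth] continuous_on_subset by blast

abbreviation \<Sigma> :: "phase set" where "\<Sigma> \<equiv> optical_hypersurface n"

text \<open>Given on all of phase space, so that it serves as the smooth ambient extension that
  \<open>vector_field_on\<close> asks for.\<close>

definition reeb :: "phase \<Rightarrow> phase" where
  "reeb z = ((1 / (n (fst z))\<^sup>2) *\<^sub>R snd z, (1 / n (fst z)) *\<^sub>R grad n (fst z))"

lemma in_hypersurface: "z \<in> \<Sigma> \<longleftrightarrow> norm (snd z) = n (fst z)"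
  using optical_hypersurface_eq[of n] n_pos by auto

lemma has_derivative_n: "(n has_derivative (\<lambda>h. h \<bullet> grad n q)) (at q)"
  using smooth_on_has_derivative[OF n_smooth] by (intro has_derivative_grad) (auto simp: differentiable_def)

lemma smooth_on_grad_n: "smooth_on UNIV (grad n)"
proof -
  have "grad n = (\<lambda>x. \<Sum>b\<in>Basis. frechet_derivative n (at x) b *\<^sub>R b)"
    using smooth_on_has_derivative[OF n_smooth]
    by (intro ext has_derivative_grad(2)) (auto simp: differentiable_def)
  moreover have "smooth_on UNIV (\<lambda>x. \<Sum>b\<in>Basis. frechet_derivative n (at x) b *\<^sub>R b)"
    by (intro smooth_on_sum smooth_on_scaleR smooth_on_frechet_derivative n_smooth smooth_on_const) auto
  ultimately show ?thesis by metis
qed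

text \<open>Half the Euclidean gradient of the optical Hamiltonian; it presents ker dH as a
  hyperplane of known dimension.\<close>

definition normal :: "phase \<Rightarrow> phase" where
  "normal z = (- n (fst z) *\<^sub>R grad n (fst z), snd z)"

lemma inner_normal: "normal z \<bullet> v = snd z \<bullet> snd v - n (fst z) * (grad n (fst z) \<bullet> fst v)"
  by (simp add: normal_def inner_prod_def)

lemma snd_inner_self: "z \<in> \<Sigma> \<Longrightarrow> snd z \<bullet> snd z = (n (fst z))\<^sup>2"
  by (simp add: in_hypersurface flip: power2_norm_eq_inner)

text \<open>The momentum component has length n > 0 on \<Sigma>, so 0 is a regular value of the
  Hamiltonian.\<close>

lemma normal_nonzero: "z \<in> \<Sigma> \<Longrightarrow> normal z \<noteq> 0"
  using snd_inner_self[of z] by (auto simp: normal_def prod_eq_iff)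

lemma has_derivative_optical_hamiltonian:
  "(optical_hamiltonian n has_derivative (\<lambda>v. 2 * (normal z \<bullet> v))) (at z)"
proof -
  have "((\<lambda>z. n (fst z)) has_derivative (\<lambda>v. fst v \<bullet> grad n (fst z))) (at z)"
    by (rule has_derivative_compose[OF has_derivative_fst[OF has_derivative_ident] has_derivative_n])
  from has_derivative_diff[OF has_derivative_norm_square_snd has_derivative_power[OF this, of 2]]
  have "(optical_hamiltonian n has_derivative
      (\<lambda>v. 2 * (snd z \<bullet> snd v) - of_nat 2 * (fst v \<bullet> grad n (fst z)) * n (fst z) ^ (2 - 1))) (at z)"
    by (simp add: optical_hamiltonian_def[abs_def])
  then show ?thesis
    unfolding inner_normal
    by (rule has_derivative_eq_rhs) (auto simp: fun_eq_iff inner_commute algebra_simps)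
qed

text \<open>The Hamiltonian is constantly 0 along a curve in \<Sigma>, so its derivative in the
  direction of the velocity vanishes.\<close>

lemma tangent_imp_normal:
  assumes "v \<in> tangent_space \<Sigma> z"
  shows "normal z \<bullet> v = 0"
proof -
  obtain \<gamma> e where e: "e > 0" and \<gamma>: "\<gamma> ` {-e<..<e} \<subseteq> \<Sigma>" "\<gamma> 0 = z"
    "(\<gamma> has_derivative (\<lambda>t. t *\<^sub>R v)) (at 0)"
    using assms by (auto simp: tangent_space_def has_vector_derivative_def)
  have "((\<lambda>t. optical_hamiltonian n (\<gamma> t)) has_derivative (\<lambda>t. 2 * (normal z \<bullet> (t *\<^sub>R v)))) (at 0)"
    using has_derivative_compose[OF \<gamma>(3) has_derivative_optical_hamiltonian] \<gamma>(2) by simp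
  then have "((\<lambda>t. 0) has_derivative (\<lambda>t. 2 * (normal z \<bullet> (t *\<^sub>R v)))) (at (0::real))"
    by (rule has_derivative_transform_within_open[of _ _ _ _ "{-e<..<e}"])
      (use e \<gamma>(1) in \<open>auto simp: optical_hypersurface_def image_subset_iff\<close>)
  then have "(\<lambda>t. 2 * (normal z \<bullet> (t *\<^sub>R v))) = (\<lambda>t::real. 0)"
    by (rule has_derivative_unique) simp
  from fun_cong[OF this, of 1] show ?thesis by simp
qed

text \<open>Dimension count: an injective image of \<open>real^5\<close> inside a hyperplane of the
  6-dimensional phase space is the whole hyperplane.\<close>

lemma range_derivative_param:
  fixes \<phi> :: "real^5 \<Rightarrow> phase"
  assumes \<phi>: "local_param \<Sigma> U \<phi>" and u: "u \<in> U"
  shows "range (frechet_derivative \<phi> (at u)) = {v. normal (\<phi> u) \<bullet> v = 0}"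
proof (rule subspace_dim_equal)
  let ?D = "frechet_derivative \<phi> (at u)"
  have "smooth_on U \<phi>" and inj: "inj ?D" and "\<phi> ` U \<subseteq> \<Sigma>"
    using \<phi> u local_param_subset[OF \<phi>] unfolding local_param_def by auto
  then have D: "linear ?D" and z: "\<phi> u \<in> \<Sigma>"
    using smooth_on_has_derivative u has_derivative_linear by blast+
  show "subspace (range ?D)"
    using D by (rule linear_subspace_image) simp
  show "subspace {v. normal (\<phi> u) \<bullet> v = 0}"
    by (rule subspace_hyperplane)
  show "range ?D \<subseteq> {v. normal (\<phi> u) \<bullet> v = 0}"
    using local_param_tangent[OF \<phi> u] tangent_imp_normal by blast
  show "dim {v. normal (\<phi> u) \<bullet> v = 0} \<le> dim (range ?D)"
    using dim_image_eq[OF D, of UNIV] inj dim_hyperplane[OF normal_nonzero[OF z]] by simp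
qed

text \<open>Stereographic projection of the momentum sphere over each point of configuration space.\<close>

lemma hypersurface_chart:
  fixes e :: real
  assumes e: "e * e = 1"
  shows "\<exists>\<phi> :: real^5 \<Rightarrow> phase. local_param \<Sigma> UNIV \<phi> \<and>
    range \<phi> = \<Sigma> \<inter> {z. n (fst z) + e * snd z $ 1 > 0}"
proof -
  \<comment> \<open>The parameter space is prescribed as \<open>real^5\<close>; any linear
    isomorphism splits it into a position and two stereographic coordinates.\<close>
  have "DIM(real^5) = DIM((real^3) \<times> real \<times> real)" by simp
  then obtain g :: "real^5 \<Rightarrow> (real^3) \<times> real \<times> real" and h
    where g: "linear g" and h: "linear h" and gh: "\<And>x. g (h x) = x" and hg: "\<And>x. h (g x) = x"
    by (rule isomorphisms_UNIV_UNIV) blast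
  \<comment> \<open>On \<Sigma> this removes exactly the centre of projection in each momentum
    sphere, the point with first coordinate \<open>- e * n q\<close> and the others 0. The first
    coordinate of the inverse projection contains 2 - D = 1 - s^2 - t^2.\<close>
  define W where "W = {z::phase. n (fst z) + e * snd z $ 1 > 0}"
  define D where "D s t = 1 + s * s + t * t" for s t :: real
  define w :: "real \<Rightarrow> real \<Rightarrow> real^3" where "w s t = (2 * s) *\<^sub>R axis 2 1 + (2 * t) *\<^sub>R axis 3 1
    + (e * (2 - D s t)) *\<^sub>R axis 1 1" for s t :: real
  define \<phi> where "\<phi> x = (case g x of (q, s, t) \<Rightarrow> (q, (n q * inverse (D s t)) *\<^sub>R w s t))" for x
  define \<psi> where "\<psi> z = h (fst z, snd z $ 2 * inverse (n (fst z) + e * snd z $ 1),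
    snd z $ 3 * inverse (n (fst z) + e * snd z $ 1))" for z :: phase
  have D: "D s t > 0" for s t
    by (simp add: D_def add_pos_nonneg)
  have w [simp]: "w s t $ 1 = e * (2 - D s t)" "w s t $ 2 = 2 * s" "w s t $ 3 = 2 * t" for s t
    by (auto simp: w_def axis_def)
  have sphere: "z \<in> \<Sigma> \<longleftrightarrow> (snd z $ 1)\<^sup>2 + (snd z $ 2)\<^sup>2 + (snd z $ 3)\<^sup>2 = (n (fst z))\<^sup>2" for z
    unfolding optical_hypersurface_def optical_hamiltonian_def power2_norm_eq_inner
      inner_vec_def sum_3 by (simp add: power2_eq_square)
  have \<phi>_\<Sigma>: "(q, (n q * inverse (D s t)) *\<^sub>R w s t) \<in> \<Sigma> \<inter> W"
    and \<psi>_\<phi>: "\<psi> (q, (n q * inverse (D s t)) *\<^sub>R w s t) = h (q, s, t)" for q s t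
  proof -
    \<comment> \<open>The denominator in \<psi> at a point of the chart is 2n/D: its positivity
      places the point in \<open>W\<close>, and dividing by it recovers the coordinates.\<close>
    have k: "n q + e * (n q * inverse (D s t) * (e * (2 - D s t))) = 2 * n q * inverse (D s t)"
    proof -
      have "n q + e * (n q * inverse (D s t) * (e * (2 - D s t)))
          = n q + (e * e) * n q * inverse (D s t) * (2 - D s t)"
        by simp
      also have "\<dots> = 2 * n q * inverse (D s t)"
        using D[of s t] e by (simp add: field_simps)
      finally show ?thesis .
    qed
    have "(e * (2 - D s t))\<^sup>2 + (2 * s)\<^sup>2 + (2 * t)\<^sup>2 = (e * e) * (2 - D s t)\<^sup>2 + 4 * (s * s + t * t)"
      by (simp add: power2_eq_square)
    also have "\<dots> = (D s t)\<^sup>2"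
      unfolding e by (simp add: D_def power2_eq_square algebra_simps)
    finally have "(n q * inverse (D s t))\<^sup>2 * ((e * (2 - D s t))\<^sup>2 + (2 * s)\<^sup>2 + (2 * t)\<^sup>2) = (n q)\<^sup>2"
      using D[of s t] by (simp add: power_mult_distrib field_simps)
    then have "(q, (n q * inverse (D s t)) *\<^sub>R w s t) \<in> \<Sigma>"
      by (simp add: sphere power_mult_distrib distrib_left)
    moreover have "0 < 2 * n q * inverse (D s t)"
      using D[of s t] n_pos[of q] by simp
    then have "(q, (n q * inverse (D s t)) *\<^sub>R w s t) \<in> W"
      by (simp only: W_def mem_Collect_eq fst_conv snd_conv vector_scaleR_component w
          real_scaleR_def k)
    ultimately show "(q, (n q * inverse (D s t)) *\<^sub>R w s t) \<in> \<Sigma> \<inter> W"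
      by blast
    have "a * inverse d * (2 * r) * inverse (2 * a * inverse d) = r" if "a \<noteq> 0" "d \<noteq> 0" for a d r :: real
      using that by (simp add: field_simps)
    from this[of "n q" "D s t"]
    have "n q * inverse (D s t) * (2 * r) * inverse (2 * n q * inverse (D s t)) = r" for r
      using D[of s t] by simp
    then show "\<psi> (q, (n q * inverse (D s t)) *\<^sub>R w s t) = h (q, s, t)"
      by (simp only: \<psi>_def fst_conv snd_conv vector_scaleR_component w real_scaleR_def k)
  qed
  have surj: "\<phi> (\<psi> z) = z" if z: "z \<in> \<Sigma> \<inter> W" for z
  proof -
    obtain q p where zqp: "z = (q, p)" by fastforce
    define k where "k = n q + e * p $ 1"
    have k: "k > 0" using z by (simp add: W_def zqp k_def)
    have p: "(p $ 1)\<^sup>2 + (p $ 2)\<^sup>2 + (p $ 3)\<^sup>2 = (n q)\<^sup>2" using z sphere by (simp add: zqp)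
    let ?s = "p $ 2 * inverse k" and ?t = "p $ 3 * inverse k"
    \<comment> \<open>The sphere equation factors as (n + e p_1)(n - e p_1) because e^2 = 1; this
      determines \<open>D\<close> at the projected point as 2n/k.\<close>
    have "(p $ 2)\<^sup>2 + (p $ 3)\<^sup>2 = (n q)\<^sup>2 - (e * e) * (p $ 1)\<^sup>2"
      using p e by simp
    also have "\<dots> = k * (n q - e * p $ 1)"
      by (simp add: k_def power2_eq_square algebra_simps)
    also have "\<dots> = k * (2 * n q - k)"
      by (simp add: k_def)
    finally have p23: "(p $ 2)\<^sup>2 + (p $ 3)\<^sup>2 = k * (2 * n q - k)" .
    have "?s * ?s + ?t * ?t = ((p $ 2)\<^sup>2 + (p $ 3)\<^sup>2) / (k * k)"
      by (simp add: power2_eq_square divide_inverse distrib_left mult_ac)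
    also have "\<dots> = (2 * n q - k) / k"
      unfolding p23 using k by simp
    finally have Dk: "D ?s ?t = 2 * n q / k"
      using k by (simp only: D_def add.assoc) (simp add: diff_divide_distrib)
    then have "n q * inverse (D ?s ?t) = k / 2"
      by simp
    moreover have "(k / 2) *\<^sub>R w ?s ?t = p"
    proof -
      have "k / 2 * (e * (2 - 2 * n q / k)) = e * (k - n q)"
        using k by (simp add: field_simps)
      also have "\<dots> = p $ 1" using e by (simp add: k_def flip: mult.assoc)
      finally show ?thesis
        using k Dk by (simp add: vec_eq_iff forall_3)
    qed
    ultimately have "(n q * inverse (D ?s ?t)) *\<^sub>R w ?s ?t = p"
      by (simp only:)
    then show ?thesis
      by (simp add: \<phi>_def \<psi>_def zqp gh flip: k_def)
  qed
  have bl: "bounded_linear g" "bounded_linear h"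
    using g h linear_conv_bounded_linear by blast+
  have g_smooth: "smooth_on UNIV (\<lambda>x. fst (g x))" "smooth_on UNIV (\<lambda>x. fst (snd (g x)))"
    "smooth_on UNIV (\<lambda>x. snd (snd (g x)))"
    by (intro smooth_on_linear_compose[OF _ bounded_linear_fst] smooth_on_linear_compose[OF _ bounded_linear_snd]
        smooth_on_linear bl open_UNIV)+
  have D_smooth: "smooth_on UNIV (\<lambda>x. D (fst (snd (g x))) (snd (snd (g x))))"
    unfolding D_def by (intro smooth_on_add smooth_on_mult smooth_on_const g_smooth open_UNIV)
  have ng: "smooth_on UNIV (\<lambda>x. n (fst (g x)))"
    by (rule smooth_on_compose[OF open_UNIV open_UNIV _ g_smooth(1) n_smooth]) simp
  have "smooth_on UNIV (\<lambda>x. 2 + - 1 * D (fst (snd (g x))) (snd (snd (g x))))"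
    by (intro smooth_on_add smooth_on_mult smooth_on_const D_smooth open_UNIV)
  then have D2: "smooth_on UNIV (\<lambda>x. 2 - D (fst (snd (g x))) (snd (snd (g x))))"
    by simp
  have "smooth_on UNIV \<phi>"
    unfolding \<phi>_def case_prod_beta w_def
    by (intro smooth_on_Pair smooth_on_scaleR smooth_on_add smooth_on_mult smooth_on_const
        smooth_on_inverse g_smooth D_smooth ng D2 open_UNIV) (metis D less_irrefl)
  moreover have pr: "smooth_on UNIV (\<lambda>z::phase. snd z $ i)" for i
    by (intro smooth_on_linear open_UNIV bounded_linear_compose[OF bounded_linear_vec_nth bounded_linear_snd])
  have f: "smooth_on UNIV (\<lambda>z::phase. fst z)"
    by (intro smooth_on_linear open_UNIV bounded_linear_fst)
  have nf: "smooth_on UNIV (\<lambda>z::phase. n (fst z))"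
    by (rule smooth_on_compose[OF open_UNIV open_UNIV _ f n_smooth]) simp
  have k: "smooth_on UNIV (\<lambda>z::phase. n (fst z) + e * snd z $ 1)"
    by (intro smooth_on_add smooth_on_mult smooth_on_const nf pr open_UNIV)
  have W: "open W"
    unfolding W_def by (intro open_Collect_less continuous_on_const smooth_on_imp_continuous_on[OF k])
  note on_W = smooth_on_subset[OF _ subset_UNIV[of W]]
  have "smooth_on W \<psi>"
    unfolding \<psi>_def
    by (intro smooth_on_linear_compose[OF W bl(2)] smooth_on_Pair smooth_on_mult smooth_on_inverse W
        on_W pr f k) (auto simp: W_def)
  moreover have "\<psi> (\<phi> x) = x" for x
  proof -
    obtain q s t where x: "g x = (q, s, t)" by (metis prod.exhaust)
    then have "h (q, s, t) = x" using hg[of x] by simp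
    then show ?thesis using \<psi>_\<phi>[of q s t] x by (simp add: \<phi>_def)
  qed
  moreover have "range \<phi> = \<Sigma> \<inter> W"
  proof
    show "range \<phi> \<subseteq> \<Sigma> \<inter> W"
      using \<phi>_\<Sigma> by (auto simp: \<phi>_def split: prod.split)
    show "\<Sigma> \<inter> W \<subseteq> range \<phi>"
      using surj by (metis rangeI subsetI)
  qed
  ultimately show ?thesis
    using local_paramI[of UNIV W \<phi> \<psi> \<Sigma>] W W_def by auto
qed

lemma submanifold_hypersurface: "submanifold TYPE(real^5) \<Sigma>"
  unfolding submanifold_def
proof
  fix z assume z: "z \<in> \<Sigma>"
  \<comment> \<open>With this sign \<open>e * snd z $ 1\<close> is the absolute value of the first
    momentum coordinate, so \<open>z\<close> avoids the excluded pole; two charts cover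
    \<Sigma>.\<close>
  define e :: real where "e = (if snd z $ 1 \<ge> 0 then 1 else - 1)"
  have e: "e * e = 1" by (simp add: e_def)
  obtain \<phi> :: "real^5 \<Rightarrow> phase" where \<phi>: "local_param \<Sigma> UNIV \<phi>"
    "range \<phi> = \<Sigma> \<inter> {z. n (fst z) + e * snd z $ 1 > 0}"
    using hypersurface_chart[OF e] by blast
  have "n (fst z) + e * snd z $ 1 > 0"
    using n_pos[of "fst z"] by (simp add: e_def)
  then show "\<exists>U (\<phi> :: real^5 \<Rightarrow> phase). local_param \<Sigma> U \<phi> \<and> z \<in> \<phi> ` U"
    using z \<phi> by blast
qed

text \<open>For the converse inclusion a chart supplies the curves: its differential is onto the
  hyperplane and takes only tangent values.\<close>

lemma tangent_space_hypersurface: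
  assumes z: "z \<in> \<Sigma>"
  shows "tangent_space \<Sigma> z = {v. normal z \<bullet> v = 0}"
proof
  show "tangent_space \<Sigma> z \<subseteq> {v. normal z \<bullet> v = 0}"
    using tangent_imp_normal by blast
  obtain U and \<phi> :: "real^5 \<Rightarrow> phase" and u where \<phi>: "local_param \<Sigma> U \<phi>" "u \<in> U" and zu: "z = \<phi> u"
    using submanifold_hypersurface z by (auto simp: submanifold_def)
  show "{v. normal z \<bullet> v = 0} \<subseteq> tangent_space \<Sigma> z"
    unfolding zu range_derivative_param[OF \<phi>, symmetric] using local_param_tangent[OF \<phi>] by blast
qed

section \<open>The contact form and its exterior derivative\<close>

abbreviation \<alpha> :: "phase \<Rightarrow> phase alt" where "\<alpha> \<equiv> optical_contact_form n"

abbreviation d\<alpha> :: "phase \<Rightarrow> phase alt" where "d\<alpha> \<equiv> ext_deriv_on TYPE(real^5) 1 \<Sigma> \<alpha>"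

lemma contact_form_eq: "z \<in> \<Sigma> \<Longrightarrow> v 0 \<in> tangent_space \<Sigma> z \<Longrightarrow> \<alpha> z v = snd z \<bullet> fst (v 0)"
  by (simp add: optical_contact_form_def restrict_form_def liouville_form_eq)

text \<open>The case distinction in \<open>restrict_form\<close> disappears, since a chart maps into
  \<Sigma> and its differential into tangent vectors.\<close>

lemma pullback_contact_form:
  assumes \<phi>: "local_param \<Sigma> U \<phi>" and u: "u \<in> U"
  shows "pullback \<phi> \<alpha> u a = snd (\<phi> u) \<bullet> fst (frechet_derivative \<phi> (at u) (a 0))"
proof -
  have "\<phi> ` U \<subseteq> \<Sigma>" using \<phi> by (rule local_param_subset)
  then show ?thesis
    unfolding pullback_def using u local_param_tangent[OF \<phi> u] by (subst contact_form_eq) auto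
qed

lemma form_on_contact_form: "form_on TYPE(real^5) 1 \<Sigma> \<alpha>"
  unfolding form_on_def
proof (intro allI impI)
  fix U and \<phi> :: "real^5 \<Rightarrow> phase"
  assume \<phi>: "local_param \<Sigma> U \<phi>"
  then have U: "open U" and sm: "smooth_on U \<phi>" by (auto simp: local_param_def)
  note pb = pullback_contact_form[OF \<phi>]
  have lin: "linear (\<lambda>b. pullback \<phi> \<alpha> u (a(0 := b)))" if u: "u \<in> U" for u a
  proof -
    have "bounded_linear (frechet_derivative \<phi> (at u))"
      using smooth_on_has_derivative[OF sm u] by (rule has_derivative_bounded_linear)
    then have "bounded_linear (\<lambda>b. snd (\<phi> u) \<bullet> fst (frechet_derivative \<phi> (at u) b))"
      by (intro bounded_linear_inner_right_comp bounded_linear_fst_comp)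
    then show ?thesis
      using pb[OF u] by (simp add: bounded_linear.linear)
  qed
  have "smooth_on U (\<lambda>u. pullback \<phi> \<alpha> u a)" for a
  proof -
    have "smooth_on U (\<lambda>u. snd (\<phi> u) \<bullet> fst (frechet_derivative \<phi> (at u) (a 0)))"
      by (intro smooth_on_inner smooth_on_linear_compose[OF U bounded_linear_fst]
          smooth_on_linear_compose[OF U bounded_linear_snd] smooth_on_frechet_derivative sm U)
    then show ?thesis
      by (subst smooth_on_cong[OF U pb])
  qed
  then show "(\<forall>u\<in>U.
       (\<forall>a b. (\<forall>i<1. a i = b i) \<longrightarrow> pullback \<phi> \<alpha> u a = pullback \<phi> \<alpha> u b) \<and>
       (\<forall>a. \<forall>i<1. linear (\<lambda>b. pullback \<phi> \<alpha> u (a(i := b)))) \<and>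
       (\<forall>a. \<forall>i<1. \<forall>j<1. i \<noteq> j \<longrightarrow> a i = a j \<longrightarrow> pullback \<phi> \<alpha> u a = 0)) \<and>
     (\<forall>a. smooth_on U (\<lambda>u. pullback \<phi> \<alpha> u a))"
    using lin by (auto simp: pb)
qed

lemma ext_deriv_pullback_contact_form:
  fixes \<phi> :: "real^5 \<Rightarrow> phase"
  assumes \<phi>: "local_param \<Sigma> U \<phi>" and u: "u \<in> U"
  defines "D \<equiv> frechet_derivative \<phi> (at u)"
  shows "ext_deriv 1 (pullback \<phi> \<alpha>) u a = snd (D (a 0)) \<bullet> fst (D (a 1)) - snd (D (a 1)) \<bullet> fst (D (a 0))"
proof -
  have U: "open U" and sm: "smooth_on U \<phi>" using \<phi> by (auto simp: local_param_def)
  let ?D2 = "\<lambda>b c. frechet_derivative (\<lambda>x. frechet_derivative \<phi> (at x) b) (at u) c"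
  have "frechet_derivative (\<lambda>x. pullback \<phi> \<alpha> x b) (at u) c
      = snd (\<phi> u) \<bullet> fst (?D2 (b 0) c) + snd (D c) \<bullet> fst (D (b 0))" for b c
  proof -
    have "((\<lambda>x. snd (\<phi> x) \<bullet> fst (frechet_derivative \<phi> (at x) (b 0))) has_derivative
        (\<lambda>c. snd (\<phi> u) \<bullet> fst (?D2 (b 0) c) + snd (D c) \<bullet> fst (D (b 0)))) (at u)"
      unfolding D_def
      by (intro has_derivative_inner has_derivative_fst has_derivative_snd
          smooth_on_has_derivative[OF sm u]
          smooth_on_has_derivative[OF smooth_on_frechet_derivative[OF sm] u])
    note fun_cong[OF frechet_derivative_eqI[OF this]]
    moreover have "frechet_derivative (\<lambda>x. pullback \<phi> \<alpha> x b) (at u)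
        = frechet_derivative (\<lambda>x. snd (\<phi> x) \<bullet> fst (frechet_derivative \<phi> (at x) (b 0))) (at u)"
      by (rule frechet_derivative_cong_open[OF U u pullback_contact_form[OF \<phi>]])
    ultimately show ?thesis by (simp only:)
  qed
  \<comment> \<open>The terms with second derivatives of \<phi> enter the alternating sum with
    opposite signs, so symmetry cancels them. What remains depends only on the two image
    vectors.\<close>
  moreover have "?D2 (a 1) (a 0) = ?D2 (a 0) (a 1)"
    by (rule mixed_derivatives_commute[OF U sm u])
  ultimately show ?thesis
    by (simp add: ext_deriv_def)
qed

text \<open>All charts give the same value, since the pulled back derivative depends only on the
  pushed forward vectors; the description is determined because a chart through \<open>z\<close>
  exists and its differential reaches \<open>v 0\<close> and \<open>v 1\<close>.\<close>

lemma d_contact_form_eq: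
  assumes z: "z \<in> \<Sigma>" and v: "v 0 \<in> tangent_space \<Sigma> z" "v 1 \<in> tangent_space \<Sigma> z"
  shows "d\<alpha> z v = snd (v 0) \<bullet> fst (v 1) - snd (v 1) \<bullet> fst (v 0)"
  unfolding ext_deriv_on_def
proof (rule the_equality, intro allI impI)
  fix U and \<phi> :: "real^5 \<Rightarrow> phase" and u a
  assume "local_param \<Sigma> U \<phi>" "u \<in> U" "\<forall>i\<le>1. frechet_derivative \<phi> (at u) (a i) = v i"
  then show "snd (v 0) \<bullet> fst (v 1) - snd (v 1) \<bullet> fst (v 0) = ext_deriv 1 (pullback \<phi> \<alpha>) u a"
    using ext_deriv_pullback_contact_form[of U \<phi> u a] by simp
next
  fix c
  assume c: "\<forall>U (\<phi> :: real^5 \<Rightarrow> phase) u a. local_param \<Sigma> U \<phi> \<longrightarrow> u \<in> U \<longrightarrow> \<phi> u = z \<longrightarrow>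
     (\<forall>i\<le>1. frechet_derivative \<phi> (at u) (a i) = v i) \<longrightarrow> c = ext_deriv 1 (pullback \<phi> \<alpha>) u a"
  obtain U and \<phi> :: "real^5 \<Rightarrow> phase" and u where \<phi>: "local_param \<Sigma> U \<phi>" "u \<in> U" "\<phi> u = z"
    using submanifold_hypersurface z by (auto simp: submanifold_def)
  let ?D = "frechet_derivative \<phi> (at u)"
  have "v 0 \<in> range ?D" "v 1 \<in> range ?D"
    using v range_derivative_param[OF \<phi>(1,2)] \<phi>(3) by (auto simp: tangent_space_hypersurface[OF z])
  then obtain a0 a1 where a: "?D a0 = v 0" "?D a1 = v 1" by auto
  define a where "a i = (if i = 0 then a0 else a1)" for i :: nat
  have Da: "\<forall>i\<le>1. ?D (a i) = v i"
    using a by (auto simp: a_def le_Suc_eq)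
  then have "c = ext_deriv 1 (pullback \<phi> \<alpha>) u a"
    using c \<phi> by blast
  then show "c = snd (v 0) \<bullet> fst (v 1) - snd (v 1) \<bullet> fst (v 0)"
    using ext_deriv_pullback_contact_form[OF \<phi>(1,2), of a] Da by simp
qed

section \<open>The contact condition and the Reeb vector field\<close>

lemma normal_reeb: "z \<in> \<Sigma> \<Longrightarrow> normal z \<bullet> reeb z = 0"
  unfolding inner_normal by (simp add: reeb_def power2_eq_square inner_commute)

lemma reeb_tangent: "z \<in> \<Sigma> \<Longrightarrow> reeb z \<in> tangent_space \<Sigma> z"
  by (simp add: tangent_space_hypersurface normal_reeb)

lemma contact_form_reeb: "z \<in> \<Sigma> \<Longrightarrow> snd z \<bullet> fst (reeb z) = 1"
  by (simp add: reeb_def snd_inner_self)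

lemma snd_nonzero: "z \<in> \<Sigma> \<Longrightarrow> snd z \<noteq> 0"
  using snd_inner_self[of z] by auto

text \<open>The Reeb vector is completed by a symplectic basis of the contact hyperplane, built from
  two vectors orthogonal to the momentum.\<close>

lemma contact_manifold_hypersurface: "contact_manifold_5 \<Sigma> \<alpha>"
  unfolding contact_manifold_5_def Let_def
proof (intro conjI ballI submanifold_hypersurface form_on_contact_form)
  fix z assume z: "z \<in> \<Sigma>"
  define p g m where "p = snd z" and "g = grad n (fst z)" and "m = n (fst z)"
  have m: "m \<noteq> 0" by (simp add: m_def)
  have pp: "p \<bullet> p = m\<^sup>2" using snd_inner_self[OF z] by (simp add: p_def m_def)
  obtain f\<^sub>1 :: "real^3" where f\<^sub>1: "f\<^sub>1 \<noteq> 0" "p \<bullet> f\<^sub>1 = 0"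
    using orthogonal_to_vector_exists[of p] by (auto simp: orthogonal_def)
  define f\<^sub>2 where "f\<^sub>2 = cross3 p f\<^sub>1"
  have f\<^sub>2: "p \<bullet> f\<^sub>2 = 0" "f\<^sub>1 \<bullet> f\<^sub>2 = 0"
    by (simp_all add: f\<^sub>2_def dot_cross_self)
  have "(norm f\<^sub>2)\<^sup>2 = (norm p * norm f\<^sub>1)\<^sup>2"
    using norm_cross_dot[of p f\<^sub>1] f\<^sub>1(2) by (simp add: f\<^sub>2_def)
  then have f\<^sub>2_nz: "f\<^sub>2 \<noteq> 0"
    using f\<^sub>1(1) snd_nonzero[OF z] by (auto simp: p_def)
  \<comment> \<open>For \<open>f\<close> orthogonal to \<open>p\<close>, the multiple of
    \<open>p\<close> is chosen to make \<open>(f, (g \<bullet> f / m) *\<^sub>R p)\<close> tangent,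
    as p has square length m^2; \<open>(0, f)\<close> is tangent already. Orthogonality to
    \<open>p\<close> also puts all four vectors in the kernel of \<alpha>.\<close>
  define v where "v i = [reeb z, (f\<^sub>1, (g \<bullet> f\<^sub>1 / m) *\<^sub>R p), (0, f\<^sub>1), (f\<^sub>2, (g \<bullet> f\<^sub>2 / m) *\<^sub>R p), (0, f\<^sub>2)] ! i"
    for i :: nat
  have v: "v 0 = reeb z" "v 1 = (f\<^sub>1, (g \<bullet> f\<^sub>1 / m) *\<^sub>R p)" "v 2 = (0, f\<^sub>1)"
    "v 3 = (f\<^sub>2, (g \<bullet> f\<^sub>2 / m) *\<^sub>R p)" "v 4 = (0, f\<^sub>2)"
    by (simp_all add: v_def)
  have less5: "i < 5 \<longleftrightarrow> i \<in> {0, 1, 2, 3, 4}" for i :: nat by auto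
  have normal: "normal z \<bullet> w = p \<bullet> snd w - m * (g \<bullet> fst w)" for w
    by (simp add: inner_normal p_def g_def m_def)
  have "normal z \<bullet> (f, (g \<bullet> f / m) *\<^sub>R p) = 0" for f
    using m by (simp add: normal pp power2_eq_square)
  moreover have "normal z \<bullet> (0, f\<^sub>1) = 0" "normal z \<bullet> (0, f\<^sub>2) = 0"
    using f\<^sub>1(2) f\<^sub>2(1) by (simp_all add: normal)
  ultimately have tangent: "v i \<in> tangent_space \<Sigma> z" if "i < 5" for i
    using that unfolding less5 tangent_space_hypersurface[OF z]
    by (auto simp: v[unfolded One_nat_def] normal_reeb[OF z])
  define w where "w i j = snd (v i) \<bullet> fst (v j) - snd (v j) \<bullet> fst (v i)" for i j
  have "wedge 1 4 (\<alpha> z) (wedge 2 2 (d\<alpha> z) (d\<alpha> z)) v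
      = 2 * 1 * (w 1 2 * w 3 4 - w 1 3 * w 2 4 + w 1 4 * w 2 3)"
  proof (rule wedge_1_4_wedge_2_2)
    fix f :: "nat \<Rightarrow> nat" assume f: "f 0 < 5"
    have "p \<bullet> fst (v i) = (if i = 0 then 1 else 0)" if "i < 5" for i
      using that unfolding less5
      by (auto simp: v[unfolded One_nat_def] f\<^sub>1[unfolded p_def] f\<^sub>2[unfolded p_def] p_def contact_form_reeb[OF z])
    then show "\<alpha> z (\<lambda>i. v (f i)) = (if f 0 = 0 then 1 else 0)"
      using f tangent[OF f] by (simp add: contact_form_eq[OF z] p_def)
  next
    fix f :: "nat \<Rightarrow> nat" assume "f 0 < 5" "f 1 < 5"
    then show "d\<alpha> z (\<lambda>i. v (f i)) = w (f 0) (f 1)"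
      unfolding w_def by (intro d_contact_form_eq[OF z] tangent)
  qed (simp add: w_def)
  \<comment> \<open>Since \<open>p\<close>, \<open>f\<^sub>1\<close> and \<open>f\<^sub>2\<close>
    are pairwise orthogonal, only \<open>w 1 2\<close> and \<open>w 3 4\<close> survive; they are
    minus the square lengths of \<open>f\<^sub>1\<close> and \<open>f\<^sub>2\<close>.\<close>
  also have "\<dots> = 2 * (f\<^sub>1 \<bullet> f\<^sub>1) * (f\<^sub>2 \<bullet> f\<^sub>2)"
    unfolding w_def v using f\<^sub>1(2) f\<^sub>2 by (simp add: inner_commute)
  also have "\<dots> \<noteq> 0"
    using f\<^sub>1(1) f\<^sub>2_nz by simp
  finally show "\<exists>v. (\<forall>i<5. v i \<in> tangent_space \<Sigma> z) \<and>
      wedge 1 4 (\<alpha> z) (wedge 2 2 (d\<alpha> z) (d\<alpha> z)) v \<noteq> 0"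
    using tangent by blast
qed

lemma smooth_on_reeb: "smooth_on UNIV reeb"
proof -
  have f: "smooth_on UNIV (\<lambda>z::phase. fst z)" and s: "smooth_on UNIV (\<lambda>z::phase. snd z)"
    by (intro smooth_on_linear open_UNIV bounded_linear_fst bounded_linear_snd)+
  have nf: "smooth_on UNIV (\<lambda>z::phase. n (fst z))" and gf: "smooth_on UNIV (\<lambda>z::phase. grad n (fst z))"
    by (rule smooth_on_compose[OF open_UNIV open_UNIV _ f]; simp add: n_smooth smooth_on_grad_n)+
  have "smooth_on UNIV (\<lambda>z::phase. (inverse (n (fst z) * n (fst z)) *\<^sub>R snd z, inverse (n (fst z)) *\<^sub>R grad n (fst z)))"
    by (intro smooth_on_Pair smooth_on_scaleR smooth_on_inverse smooth_on_mult open_UNIV nf gf s) auto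
  then show ?thesis
    by (simp add: reeb_def[abs_def] power2_eq_square inverse_eq_divide)
qed

lemma reeb_field_reeb: "reeb_field_5 \<Sigma> \<alpha> (restrict reeb \<Sigma>)"
  unfolding reeb_field_5_def vector_field_on_def
proof (intro conjI ballI allI impI)
  fix z assume z: "z \<in> \<Sigma>"
  show "restrict reeb \<Sigma> z \<in> tangent_space \<Sigma> z"
    using z by (simp add: reeb_tangent)
  show "\<exists>W Y. open W \<and> z \<in> W \<and> smooth_on W Y \<and> (\<forall>y\<in>W \<inter> \<Sigma>. Y y = restrict reeb \<Sigma> y)"
    by (intro exI[of _ UNIV] exI[of _ reeb]) (simp add: smooth_on_reeb)
  show "contract (restrict reeb \<Sigma> z) (\<alpha> z) v = 1" for v
    using z by (simp add: contract_def contact_form_eq reeb_tangent contact_form_reeb)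
  fix v :: "nat \<Rightarrow> phase" assume v: "v 0 \<in> tangent_space \<Sigma> z"
  then have "normal z \<bullet> v 0 = 0" by (rule tangent_imp_normal)
  moreover have "d\<alpha> z (case_nat (reeb z) v) = snd (reeb z) \<bullet> fst (v 0) - snd (v 0) \<bullet> fst (reeb z)"
    using d_contact_form_eq[OF z, of "case_nat (reeb z) v"] v reeb_tangent[OF z] by simp
  \<comment> \<open>Contracting d\<alpha> with the Reeb vector gives a multiple of dH, which kills
    tangent vectors.\<close>
  moreover have "\<dots> = - (1 / (n (fst z))\<^sup>2) * (normal z \<bullet> v 0)"
    unfolding inner_normal reeb_def by (simp add: power2_eq_square inner_commute field_simps)
  ultimately show "contract (restrict reeb \<Sigma> z) (d\<alpha> z) v = 0"
    using z by (simp add: contract_def)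
qed simp

text \<open>Every covector vanishing on the tangent space is a multiple of \<open>dH\<close>; the normalisation
  determines the factor.\<close>

lemma reeb_field_unique:
  assumes R: "reeb_field_5 \<Sigma> \<alpha> R" and z: "z \<in> \<Sigma>"
  shows "R z = reeb z"
proof -
  define c where "c = normal z"
  \<comment> \<open>The vector that represents d\<alpha>(R, .) in the Euclidean inner
    product.\<close>
  define u where "u = (snd (R z), - fst (R z))"
  have Rz: "R z \<in> tangent_space \<Sigma> z"
    using R z by (simp add: reeb_field_5_def vector_field_on_def)
  have uw: "u \<bullet> w = 0" if "c \<bullet> w = 0" for w
  proof -
    have w: "w \<in> tangent_space \<Sigma> z"
      using that by (simp add: tangent_space_hypersurface[OF z] c_def)
    then have "contract (R z) (d\<alpha> z) (\<lambda>_. w) = 0"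
      using R z by (simp add: reeb_field_5_def)
    moreover have "d\<alpha> z (case_nat (R z) (\<lambda>_. w)) = snd (R z) \<bullet> fst w - snd w \<bullet> fst (R z)"
      using d_contact_form_eq[OF z, of "case_nat (R z) (\<lambda>_. w)"] Rz w by simp
    ultimately show ?thesis
      by (simp add: contract_def u_def inner_prod_def inner_commute)
  qed
  \<comment> \<open>The coefficient of the orthogonal projection of \<open>u\<close> to the normal
    \<open>c\<close>. The remainder is orthogonal to \<open>c\<close>, hence tangent, hence
    orthogonal to \<open>u\<close> as well, and so orthogonal to itself.\<close>
  define l where "l = (c \<bullet> u) / (c \<bullet> c)"
  have "c \<bullet> c \<noteq> 0" using normal_nonzero[OF z] by (simp add: c_def)
  then have c0: "c \<bullet> (u - l *\<^sub>R c) = 0"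
    by (simp add: inner_diff_right l_def)
  then have "(u - l *\<^sub>R c) \<bullet> (u - l *\<^sub>R c) = 0"
    using uw[OF c0] by (simp add: inner_diff_left)
  then have "u = l *\<^sub>R c" by simp
  then have "snd (R z) = - (l * n (fst z)) *\<^sub>R grad n (fst z)" "- fst (R z) = l *\<^sub>R snd z"
    by (auto simp: u_def c_def normal_def)
  then have ab: "snd (R z) = - (l * n (fst z)) *\<^sub>R grad n (fst z)" "fst (R z) = - l *\<^sub>R snd z"
    by (simp_all add: minus_equation_iff[of "fst (R z)"])
  have "contract (R z) (\<alpha> z) (\<lambda>_. 0) = 1"
    using R z by (simp add: reeb_field_5_def)
  then have "snd z \<bullet> fst (R z) = 1"
    using Rz by (simp add: contract_def contact_form_eq[OF z])
  then have "- l * (n (fst z))\<^sup>2 = 1"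
    by (simp add: ab snd_inner_self[OF z])
  then have "l = - (1 / (n (fst z))\<^sup>2)"
    by (simp add: field_simps)
  then show ?thesis
    by (simp add: prod_eq_iff ab reeb_def power2_eq_square)
qed

text \<open>Nondegeneracy of the symplectic form: testing against purely vertical and purely
  horizontal vectors reads off the two components, at every point of phase space.\<close>

lemma hamiltonian_vector_field_eq:
  assumes "is_hamiltonian_vector_field (optical_hamiltonian n) X"
  shows "X z = (2 *\<^sub>R snd z, (2 * n (fst z)) *\<^sub>R grad n (fst z))"
proof -
  have X: "fst (X z) \<bullet> snd w - fst w \<bullet> snd (X z) = 2 * (normal z \<bullet> w)" for w
  proof -
    have "contract (X z) (symplectic_form z) (\<lambda>_. w) = ext_deriv 0 (\<lambda>y _. optical_hamiltonian n y) z (\<lambda>_. w)"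
      using fun_cong[OF assms[unfolded is_hamiltonian_vector_field_def, rule_format]] .
    then show ?thesis
      by (simp add: contract_def symplectic_form_eq ext_deriv_def
          frechet_derivative_eqI[OF has_derivative_optical_hamiltonian])
  qed
  have "fst (X z) \<bullet> h = (2 *\<^sub>R snd z) \<bullet> h" for h
    using X[of "(0, h)"] by (simp add: inner_normal)
  moreover have "snd (X z) \<bullet> h = ((2 * n (fst z)) *\<^sub>R grad n (fst z)) \<bullet> h" for h
    using X[of "(h, 0)"] unfolding inner_normal by (simp add: inner_commute)
  ultimately have "fst (X z) = 2 *\<^sub>R snd z" "snd (X z) = (2 * n (fst z)) *\<^sub>R grad n (fst z)"
    using vector_eq_rdot by blast+
  then show ?thesis
    by (simp add: prod_eq_iff)
qed


section \<open>Rays and Reeb orbits\<close>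

text \<open>A Reeb field is known only on \<Sigma>, being \<open>undefined\<close> elsewhere; this
  suffices because orbits stay in \<Sigma>. The equation is split into position and momentum, the
  form in which parameters are changed below.\<close>

lemma orbit_iff:
  assumes "\<forall>z\<in>\<Sigma>. R z = reeb z"
  shows "integral_curve \<Sigma> R J \<gamma> \<longleftrightarrow> open_interval J \<and> (\<forall>t\<in>J. \<gamma> t \<in> \<Sigma> \<and>
    ((\<lambda>t. fst (\<gamma> t)) has_vector_derivative (1 / (n (fst (\<gamma> t)))\<^sup>2) *\<^sub>R snd (\<gamma> t)) (at t) \<and>
    ((\<lambda>t. snd (\<gamma> t)) has_vector_derivative (1 / n (fst (\<gamma> t))) *\<^sub>R grad n (fst (\<gamma> t))) (at t))"
proof -
  have "(\<gamma> has_vector_derivative (a, b)) (at t) \<longleftrightarrow>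
      ((\<lambda>t. fst (\<gamma> t)) has_vector_derivative a) (at t) \<and>
      ((\<lambda>t. snd (\<gamma> t)) has_vector_derivative b) (at t)" for a b t
  proof safe
    assume g: "(\<gamma> has_vector_derivative (a, b)) (at t)"
    show "((\<lambda>t. fst (\<gamma> t)) has_vector_derivative a) (at t)"
      using bounded_linear.has_vector_derivative[OF bounded_linear_fst g] by simp
    show "((\<lambda>t. snd (\<gamma> t)) has_vector_derivative b) (at t)"
      using bounded_linear.has_vector_derivative[OF bounded_linear_snd g] by simp
  next
    assume "((\<lambda>t. fst (\<gamma> t)) has_vector_derivative a) (at t)"
      "((\<lambda>t. snd (\<gamma> t)) has_vector_derivative b) (at t)"
    then show "(\<gamma> has_vector_derivative (a, b)) (at t)"
      unfolding has_vector_derivative_def using has_derivative_Pair by fastforce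
  qed
  then show ?thesis
    unfolding integral_curve_def using assms by (auto simp: reeb_def)
qed

lemma ray_to_orbit:
  assumes R: "\<forall>z\<in>\<Sigma>. R z = reeb z" and ray: "is_ray n I q"
  shows "\<exists>J \<gamma>. integral_curve \<Sigma> R J \<gamma> \<and> reparametrises I q J (\<lambda>t. fst (\<gamma> t))"
proof -
  define v where "v s = vector_derivative q (at s)" for s
  have I: "open_interval I" and q: "\<And>s. s \<in> I \<Longrightarrow> (q has_vector_derivative v s) (at s)"
    and v: "\<And>s. s \<in> I \<Longrightarrow> norm (v s) = 1"
    and nv: "\<And>s. s \<in> I \<Longrightarrow> ((\<lambda>r. n (q r) *\<^sub>R v r) has_vector_derivative grad n (q s)) (at s)"
    using ray unfolding is_ray_def v_def by (auto simp: vector_derivative_works)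
  have "continuous_on I q"
    using q has_vector_derivative_continuous continuous_at_imp_continuous_on by blast
  then have c: "continuous_on I (\<lambda>s. n (q s))"
    by (rule continuous_on_compose2[OF n_continuous[of UNIV]]) simp
  obtain \<tau> \<sigma> J where J: "open_interval J" and \<tau>: "\<tau> ` I = J"
    "\<And>s. s \<in> I \<Longrightarrow> (\<tau> has_real_derivative n (q s)) (at s)" "\<And>s. s \<in> I \<Longrightarrow> \<sigma> (\<tau> s) = s"
    and \<sigma>: "\<And>t. t \<in> J \<Longrightarrow> \<sigma> t \<in> I"
    "\<And>t. t \<in> J \<Longrightarrow> (\<sigma> has_real_derivative inverse (n (q (\<sigma> t)))) (at t)"
    using time_change[OF I c n_pos] by metis
  \<comment> \<open>The lift of a ray has momentum n dq/ds, of length n by unit speed. Reeb time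
    satisfies dt = n ds, so \<sigma> recovers arc length from it.\<close>
  define \<gamma> where "\<gamma> t = (q (\<sigma> t), n (q (\<sigma> t)) *\<^sub>R v (\<sigma> t))" for t
  have "integral_curve \<Sigma> R J \<gamma>"
    unfolding orbit_iff[OF R]
  proof (intro conjI ballI J)
    fix t assume t: "t \<in> J"
    show "\<gamma> t \<in> \<Sigma>"
      using v[OF \<sigma>(1)[OF t]] n_pos by (simp add: in_hypersurface \<gamma>_def abs_of_pos)
    show "((\<lambda>t. fst (\<gamma> t)) has_vector_derivative (1 / (n (fst (\<gamma> t)))\<^sup>2) *\<^sub>R snd (\<gamma> t)) (at t)"
      using has_vector_derivative_real_chain[OF \<sigma>(2)[OF t] q[OF \<sigma>(1)[OF t]]]
      by (simp add: \<gamma>_def power2_eq_square inverse_eq_divide)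
    show "((\<lambda>t. snd (\<gamma> t)) has_vector_derivative
        (1 / n (fst (\<gamma> t))) *\<^sub>R grad n (fst (\<gamma> t))) (at t)"
      using has_vector_derivative_real_chain[OF \<sigma>(2)[OF t] nv[OF \<sigma>(1)[OF t]]]
      by (simp add: \<gamma>_def inverse_eq_divide)
  qed
  moreover have "reparametrises I q J (\<lambda>t. fst (\<gamma> t))"
    unfolding reparametrises_def
    by (intro exI[of _ \<tau>] exI[of _ "\<lambda>s. n (q s)"]) (auto simp: \<tau> c n_pos \<gamma>_def)
  ultimately show ?thesis by blast
qed

lemma orbit_continuous:
  assumes R: "\<forall>z\<in>\<Sigma>. R z = reeb z" and orbit: "integral_curve \<Sigma> R J \<gamma>"
  shows "continuous_on J (\<lambda>t. n (fst (\<gamma> t)))"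
proof -
  have "continuous_on J (\<lambda>t. fst (\<gamma> t))"
    using orbit[unfolded orbit_iff[OF R]]
    by (intro continuous_at_imp_continuous_on) (auto intro: has_vector_derivative_continuous)
  then show ?thesis
    by (rule continuous_on_compose2[OF n_continuous[of UNIV]]) simp
qed

lemma orbit_to_ray:
  assumes R: "\<forall>z\<in>\<Sigma>. R z = reeb z" and orbit: "integral_curve \<Sigma> R J \<gamma>"
  shows "\<exists>I q. is_ray n I q \<and> reparametrises I q J (\<lambda>t. fst (\<gamma> t))"
proof -
  have J: "open_interval J" and \<gamma>: "\<And>t. t \<in> J \<Longrightarrow> norm (snd (\<gamma> t)) = n (fst (\<gamma> t))"
    and d\<gamma>: "\<And>t. t \<in> J \<Longrightarrow> ((\<lambda>t. fst (\<gamma> t)) has_vector_derivative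
        (1 / (n (fst (\<gamma> t)))\<^sup>2) *\<^sub>R snd (\<gamma> t)) (at t)"
      "\<And>t. t \<in> J \<Longrightarrow> ((\<lambda>t. snd (\<gamma> t)) has_vector_derivative
        (1 / n (fst (\<gamma> t))) *\<^sub>R grad n (fst (\<gamma> t))) (at t)"
    using orbit[unfolded orbit_iff[OF R]] in_hypersurface by auto
  have c: "continuous_on J (\<lambda>t. n (fst (\<gamma> t)))"
    using orbit_continuous[OF R orbit] .
  then have "continuous_on J (\<lambda>t. inverse (n (fst (\<gamma> t))))"
    by (intro continuous_on_inverse) auto
  \<comment> \<open>The orbit has speed 1/n in configuration space, so \<mu> is arc length and its
    inverse \<nu>, with rate n, parametrises the ray.\<close>
  then obtain \<mu> \<nu> I where I: "open_interval I" and \<nu>: "\<nu> ` I = J" "\<And>s. s \<in> I \<Longrightarrow> \<nu> s \<in> J"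
    "\<And>s. s \<in> I \<Longrightarrow> (\<nu> has_real_derivative inverse (inverse (n (fst (\<gamma> (\<nu> s)))))) (at s)"
    using time_change[OF J, of "\<lambda>t. inverse (n (fst (\<gamma> t)))"] n_pos by (metis positive_imp_inverse_positive)
  note d\<nu> = \<nu>(3)[unfolded inverse_inverse_eq]
  define q where "q s = fst (\<gamma> (\<nu> s))" for s
  have dq: "(q has_vector_derivative (1 / n (q s)) *\<^sub>R snd (\<gamma> (\<nu> s))) (at s)" if "s \<in> I" for s
    using has_vector_derivative_real_chain[OF d\<nu>[OF that] d\<gamma>(1)[OF \<nu>(2)[OF that]]]
    unfolding q_def by (simp add: power2_eq_square)
  have dq': "vector_derivative q (at s) = (1 / n (q s)) *\<^sub>R snd (\<gamma> (\<nu> s))" if "s \<in> I" for s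
    using vector_derivative_at[OF dq[OF that]] .
  have "is_ray n I q"
    unfolding is_ray_def
  proof (intro conjI ballI I)
    fix s assume s: "s \<in> I"
    show "q differentiable at s"
      using dq[OF s] differentiableI_vector by blast
    show "norm (vector_derivative q (at s)) = 1"
      using \<gamma>[OF \<nu>(2)[OF s]] n_pos by (simp add: dq'[OF s] q_def abs_of_pos)
    have "((\<lambda>r. snd (\<gamma> (\<nu> r))) has_vector_derivative grad n (q s)) (at s)"
      using has_vector_derivative_real_chain[OF d\<nu>[OF s] d\<gamma>(2)[OF \<nu>(2)[OF s]]]
      unfolding q_def by simp
    \<comment> \<open>On the open interval \<open>I\<close> the optical momentum n dq/ds coincides
      with the momentum of the orbit, whose derivative is known.\<close>
    then show "((\<lambda>r. n (q r) *\<^sub>R vector_derivative q (at r)) has_vector_derivative grad n (q s)) (at s)"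
      by (rule has_vector_derivative_transform_within_open[of _ _ _ I])
        (use I s in \<open>auto simp: open_interval_def dq'\<close>)
  qed
  moreover have "reparametrises I q J (\<lambda>t. fst (\<gamma> t))"
    unfolding reparametrises_def
  proof (intro exI conjI ballI)
    show "continuous_on I (\<lambda>s. n (fst (\<gamma> (\<nu> s))))"
      using d\<nu> \<nu> by (intro continuous_on_compose2[OF c])
        (auto intro!: continuous_at_imp_continuous_on intro: DERIV_isCont)
  qed (auto simp: \<nu> d\<nu> n_pos q_def)
  ultimately show ?thesis by blast
qed

text \<open>Unit speed forces the change of parameter between a ray and its orbit.\<close>

lemma projection_speed:
  assumes R: "\<forall>z\<in>\<Sigma>. R z = reeb z" and orbit: "integral_curve \<Sigma> R J \<gamma>"
    and ray: "is_ray n I q" and proj: "reparametrises I q J (\<lambda>t. fst (\<gamma> t))"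
  obtains \<tau> where "\<tau> ` I = J" "\<And>s. s \<in> I \<Longrightarrow> (\<tau> has_real_derivative n (q s)) (at s)"
    "\<And>s. s \<in> I \<Longrightarrow> \<gamma> (\<tau> s) = (q s, n (q s) *\<^sub>R vector_derivative q (at s))"
proof -
  obtain \<tau> \<tau>' where \<tau>: "\<tau> ` I = J"
    and \<tau>': "\<And>s. s \<in> I \<Longrightarrow> (\<tau> has_real_derivative \<tau>' s) (at s) \<and> \<tau>' s > 0 \<and> q s = fst (\<gamma> (\<tau> s))"
    using proj by (auto simp: reparametrises_def)
  have "\<tau>' s = n (q s) \<and> \<gamma> (\<tau> s) = (q s, n (q s) *\<^sub>R vector_derivative q (at s))" if s: "s \<in> I" for s
  proof -
    have t: "\<tau> s \<in> J" using s \<tau> by blast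
    have g: "norm (snd (\<gamma> (\<tau> s))) = n (q s)"
      "((\<lambda>t. fst (\<gamma> t)) has_vector_derivative (1 / (n (q s))\<^sup>2) *\<^sub>R snd (\<gamma> (\<tau> s))) (at (\<tau> s))"
      using orbit[unfolded orbit_iff[OF R]] t \<tau>'[OF s] in_hypersurface by auto
    have "((\<lambda>s. fst (\<gamma> (\<tau> s))) has_vector_derivative
        \<tau>' s *\<^sub>R (1 / (n (q s))\<^sup>2) *\<^sub>R snd (\<gamma> (\<tau> s))) (at s)"
      using has_vector_derivative_real_chain g(2) \<tau>'[OF s] by blast
    then have "(q has_vector_derivative \<tau>' s *\<^sub>R (1 / (n (q s))\<^sup>2) *\<^sub>R snd (\<gamma> (\<tau> s))) (at s)"
      by (rule has_vector_derivative_transform_within_open[of _ _ _ I])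
        (use ray s \<tau>' in \<open>auto simp: open_interval_def is_ray_def\<close>)
    then have v: "vector_derivative q (at s) = (\<tau>' s / (n (q s))\<^sup>2) *\<^sub>R snd (\<gamma> (\<tau> s))"
      by (simp add: vector_derivative_at)
    moreover have "norm (vector_derivative q (at s)) = 1"
      using ray s by (simp add: is_ray_def)
    \<comment> \<open>The momentum has length n, so unit speed reads \<tau>' n / n^2 = 1. Once
      \<tau>' = n, the velocity determines the momentum.\<close>
    ultimately have "\<tau>' s * n (q s) = (n (q s))\<^sup>2"
      using \<tau>'[OF s] n_pos[of "q s"] g(1) by (simp add: abs_of_pos field_simps)
    then have "\<tau>' s = n (q s)"
      by (simp add: power2_eq_square)
    then show ?thesis
      using v \<tau>'[OF s] by (simp add: power2_eq_square prod_eq_iff)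
  qed
  then show thesis using that[of \<tau>] \<tau> \<tau>' by metis
qed

text \<open>Both changes of parameter are antiderivatives of n along the ray, and position and
  velocity of the ray fix the phase space point.\<close>

lemma orbit_of_ray_unique:
  assumes R: "\<forall>z\<in>\<Sigma>. R z = reeb z" and ray: "is_ray n I q"
    and 1: "integral_curve \<Sigma> R J\<^sub>1 \<gamma>\<^sub>1" "reparametrises I q J\<^sub>1 (\<lambda>t. fst (\<gamma>\<^sub>1 t))"
    and 2: "integral_curve \<Sigma> R J\<^sub>2 \<gamma>\<^sub>2" "reparametrises I q J\<^sub>2 (\<lambda>t. fst (\<gamma>\<^sub>2 t))"
  shows "equal_up_to_shift J\<^sub>1 \<gamma>\<^sub>1 J\<^sub>2 \<gamma>\<^sub>2"
proof -
  obtain \<tau>\<^sub>1 where \<tau>\<^sub>1: "\<tau>\<^sub>1 ` I = J\<^sub>1" "\<And>s. s \<in> I \<Longrightarrow> (\<tau>\<^sub>1 has_real_derivative n (q s)) (at s)"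
    "\<And>s. s \<in> I \<Longrightarrow> \<gamma>\<^sub>1 (\<tau>\<^sub>1 s) = (q s, n (q s) *\<^sub>R vector_derivative q (at s))"
    using projection_speed[OF R 1(1) ray 1(2)] by metis
  obtain \<tau>\<^sub>2 where \<tau>\<^sub>2: "\<tau>\<^sub>2 ` I = J\<^sub>2" "\<And>s. s \<in> I \<Longrightarrow> (\<tau>\<^sub>2 has_real_derivative n (q s)) (at s)"
    "\<And>s. s \<in> I \<Longrightarrow> \<gamma>\<^sub>2 (\<tau>\<^sub>2 s) = (q s, n (q s) *\<^sub>R vector_derivative q (at s))"
    using projection_speed[OF R 2(1) ray 2(2)] by metis
  have "open_interval I" using ray by (simp add: is_ray_def)
  then obtain c where c: "\<And>s. s \<in> I \<Longrightarrow> \<tau>\<^sub>2 s = \<tau>\<^sub>1 s + c"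
    using same_derivative_imp_shift[of I \<tau>\<^sub>1 "\<lambda>s. n (q s)" \<tau>\<^sub>2] \<tau>\<^sub>1(2) \<tau>\<^sub>2(2) by metis
  have "J\<^sub>2 = (\<lambda>t. t + c) ` J\<^sub>1"
    unfolding \<tau>\<^sub>1(1)[symmetric] \<tau>\<^sub>2(1)[symmetric] image_image by (rule image_cong) (simp_all add: c)
  moreover have "\<gamma>\<^sub>2 (t + c) = \<gamma>\<^sub>1 t" if t: "t \<in> J\<^sub>1" for t
  proof -
    obtain s where "s \<in> I" "t = \<tau>\<^sub>1 s" using t \<tau>\<^sub>1(1) by blast
    then show ?thesis using c \<tau>\<^sub>1(3) \<tau>\<^sub>2(3) by metis
  qed
  ultimately show ?thesis by (auto simp: equal_up_to_shift_def)
qed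

text \<open>Arc length \<mu> along the orbit serves as a common clock: it reproduces the parameter
  of every ray projected from the orbit, up to a constant.\<close>

lemma ray_of_orbit_unique:
  assumes R: "\<forall>z\<in>\<Sigma>. R z = reeb z" and orbit: "integral_curve \<Sigma> R J \<gamma>"
    and 1: "is_ray n I\<^sub>1 q\<^sub>1" "reparametrises I\<^sub>1 q\<^sub>1 J (\<lambda>t. fst (\<gamma> t))"
    and 2: "is_ray n I\<^sub>2 q\<^sub>2" "reparametrises I\<^sub>2 q\<^sub>2 J (\<lambda>t. fst (\<gamma> t))"
  shows "equal_up_to_shift I\<^sub>1 q\<^sub>1 I\<^sub>2 q\<^sub>2"
proof -
  have J: "open_interval J" using orbit by (simp add: integral_curve_def)
  have "continuous_on J (\<lambda>t. inverse (n (fst (\<gamma> t))))"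
    using orbit_continuous[OF R orbit] by (intro continuous_on_inverse) auto
  then obtain \<mu> where \<mu>: "\<And>t. t \<in> J \<Longrightarrow> (\<mu> has_real_derivative inverse (n (fst (\<gamma> t)))) (at t)"
    and inj: "inj_on \<mu> J"
    using time_change[OF J, of "\<lambda>t. inverse (n (fst (\<gamma> t)))"] n_pos
    by (metis inj_on_inverseI positive_imp_inverse_positive)
  have arc: "\<exists>\<tau> c. \<tau> ` I = J \<and> (\<forall>s\<in>I. q s = fst (\<gamma> (\<tau> s)) \<and> \<mu> (\<tau> s) = s + c)"
    if ray: "is_ray n I q" and proj: "reparametrises I q J (\<lambda>t. fst (\<gamma> t))" for I q
  proof -
    obtain \<tau> where \<tau>: "\<tau> ` I = J" "\<And>s. s \<in> I \<Longrightarrow> (\<tau> has_real_derivative n (q s)) (at s)"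
      "\<And>s. s \<in> I \<Longrightarrow> \<gamma> (\<tau> s) = (q s, n (q s) *\<^sub>R vector_derivative q (at s))"
      using projection_speed[OF R orbit ray proj] by metis
    have "((\<lambda>s. \<mu> (\<tau> s)) has_real_derivative 1) (at s)" if s: "s \<in> I" for s
    proof -
      have "\<tau> s \<in> J" using \<tau>(1) s by blast
      from DERIV_chain2[OF \<mu>[OF this] \<tau>(2)[OF s]] show ?thesis
        by (simp add: \<tau>(3)[OF s])
    qed
    moreover have "open_interval I" using ray by (simp add: is_ray_def)
    ultimately obtain c where "\<And>s. s \<in> I \<Longrightarrow> \<mu> (\<tau> s) = s + c"
      using same_derivative_imp_shift[of I "\<lambda>s. s" "\<lambda>_. 1" "\<lambda>s. \<mu> (\<tau> s)"] by auto
    then show ?thesis using \<tau>(1,3) by auto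
  qed
  obtain \<tau>\<^sub>1 c\<^sub>1 where \<tau>\<^sub>1: "\<tau>\<^sub>1 ` I\<^sub>1 = J" "\<And>s. s \<in> I\<^sub>1 \<Longrightarrow> q\<^sub>1 s = fst (\<gamma> (\<tau>\<^sub>1 s)) \<and> \<mu> (\<tau>\<^sub>1 s) = s + c\<^sub>1"
    using arc[OF 1] by metis
  obtain \<tau>\<^sub>2 c\<^sub>2 where \<tau>\<^sub>2: "\<tau>\<^sub>2 ` I\<^sub>2 = J" "\<And>s. s \<in> I\<^sub>2 \<Longrightarrow> q\<^sub>2 s = fst (\<gamma> (\<tau>\<^sub>2 s)) \<and> \<mu> (\<tau>\<^sub>2 s) = s + c\<^sub>2"
    using arc[OF 2] by metis
  \<comment> \<open>Parameters \<open>s\<close> and \<open>r\<close> of the same orbit point satisfy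
    \<open>s + c\<^sub>1 = r + c\<^sub>2\<close>.\<close>
  define b where "b = c\<^sub>1 - c\<^sub>2"
  have 12: "s + b \<in> I\<^sub>2 \<and> \<tau>\<^sub>2 (s + b) = \<tau>\<^sub>1 s" if s: "s \<in> I\<^sub>1" for s
  proof -
    obtain r where r: "r \<in> I\<^sub>2" "\<tau>\<^sub>2 r = \<tau>\<^sub>1 s" using \<tau>\<^sub>1(1) \<tau>\<^sub>2(1) s by (metis imageE imageI)
    then have "r = s + b" using \<tau>\<^sub>1(2)[OF s] \<tau>\<^sub>2(2)[OF r(1)] by (simp add: b_def)
    then show ?thesis using r by simp
  qed
  have 21: "r - b \<in> I\<^sub>1" if r: "r \<in> I\<^sub>2" for r
  proof -
    obtain s where s: "s \<in> I\<^sub>1" "\<tau>\<^sub>1 s = \<tau>\<^sub>2 r" using \<tau>\<^sub>1(1) \<tau>\<^sub>2(1) r by (metis imageE imageI)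
    then have "r - b = s" using \<tau>\<^sub>1(2)[OF s(1)] \<tau>\<^sub>2(2)[OF r] by (simp add: b_def)
    then show ?thesis using s by simp
  qed
  have "I\<^sub>2 = (\<lambda>s. s + b) ` I\<^sub>1"
    using 12 21 by (force simp: image_iff)
  moreover have "q\<^sub>2 (s + b) = q\<^sub>1 s" if "s \<in> I\<^sub>1" for s
    using 12[OF that] \<tau>\<^sub>1(2)[OF that] \<tau>\<^sub>2(2) by metis
  ultimately show ?thesis by (auto simp: equal_up_to_shift_def)
qed

text \<open>Hamilton's equations are the flow of the Hamiltonian field, which is 2n^2 times the Reeb
  field on \<Sigma>; Reeb time is therefore an antiderivative of \<open>?f\<close>. The curve keeps
  its momentum, so no lifting is involved.\<close>

lemma phase_space_ray_to_orbit:
  assumes R: "\<forall>z\<in>\<Sigma>. R z = reeb z" and ray: "is_phase_space_ray n I c"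
  shows "\<exists>J \<gamma>. integral_curve \<Sigma> R J \<gamma> \<and> reparametrises I c J \<gamma>"
proof -
  let ?f = "\<lambda>s. 2 * (n (fst (c s)))\<^sup>2"
  have I: "open_interval I" and c: "\<And>s. s \<in> I \<Longrightarrow> c s \<in> \<Sigma>"
    and dc: "\<And>s. s \<in> I \<Longrightarrow> ((\<lambda>r. fst (c r)) has_vector_derivative 2 *\<^sub>R snd (c s)) (at s)"
      "\<And>s. s \<in> I \<Longrightarrow> ((\<lambda>r. snd (c r)) has_vector_derivative
        (2 * n (fst (c s))) *\<^sub>R grad n (fst (c s))) (at s)"
    using ray by (auto simp: is_phase_space_ray_def optical_hypersurface_def)
  have "continuous_on I (\<lambda>r. fst (c r))"
    using dc(1) has_vector_derivative_continuous continuous_at_imp_continuous_on by blast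
  then have "continuous_on I (\<lambda>s. n (fst (c s)))"
    by (rule continuous_on_compose2[OF n_continuous[of UNIV]]) simp
  then have f: "continuous_on I ?f" by (intro continuous_intros)
  have pos: "?f s > 0" for s using n_pos by simp
  obtain \<tau> \<sigma> J where J: "open_interval J" and \<tau>: "\<tau> ` I = J"
    "\<And>s. s \<in> I \<Longrightarrow> (\<tau> has_real_derivative ?f s) (at s)" "\<And>s. s \<in> I \<Longrightarrow> \<sigma> (\<tau> s) = s"
    and \<sigma>: "\<And>t. t \<in> J \<Longrightarrow> \<sigma> t \<in> I"
    "\<And>t. t \<in> J \<Longrightarrow> (\<sigma> has_real_derivative inverse (?f (\<sigma> t))) (at t)"
    using time_change[OF I f pos] by metis
  have "integral_curve \<Sigma> R J (\<lambda>t. c (\<sigma> t))"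
    unfolding orbit_iff[OF R]
  proof (intro conjI ballI J)
    fix t assume t: "t \<in> J"
    show "c (\<sigma> t) \<in> \<Sigma>" using c \<sigma>(1) t by blast
    show "((\<lambda>t. fst (c (\<sigma> t))) has_vector_derivative
        (1 / (n (fst (c (\<sigma> t))))\<^sup>2) *\<^sub>R snd (c (\<sigma> t))) (at t)"
      using has_vector_derivative_real_chain[OF \<sigma>(2)[OF t] dc(1)[OF \<sigma>(1)[OF t]]]
      by (simp add: power2_eq_square inverse_eq_divide)
    show "((\<lambda>t. snd (c (\<sigma> t))) has_vector_derivative
        (1 / n (fst (c (\<sigma> t)))) *\<^sub>R grad n (fst (c (\<sigma> t)))) (at t)"
      using has_vector_derivative_real_chain[OF \<sigma>(2)[OF t] dc(2)[OF \<sigma>(1)[OF t]]]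
      by (simp add: power2_eq_square inverse_eq_divide)
  qed
  moreover have "reparametrises I c J (\<lambda>t. c (\<sigma> t))"
    unfolding reparametrises_def
    by (intro exI[of _ \<tau>] exI[of _ ?f]) (auto simp: \<tau> f n_pos)
  ultimately show ?thesis by blast
qed

lemma orbit_to_phase_space_ray:
  assumes R: "\<forall>z\<in>\<Sigma>. R z = reeb z" and orbit: "integral_curve \<Sigma> R J \<gamma>"
  shows "\<exists>I c. is_phase_space_ray n I c \<and> reparametrises I c J \<gamma>"
proof -
  let ?f = "\<lambda>t. 2 * (n (fst (\<gamma> t)))\<^sup>2"
  have J: "open_interval J" and \<gamma>: "\<And>t. t \<in> J \<Longrightarrow> \<gamma> t \<in> \<Sigma>"
    and d\<gamma>: "\<And>t. t \<in> J \<Longrightarrow> ((\<lambda>t. fst (\<gamma> t)) has_vector_derivative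
        (1 / (n (fst (\<gamma> t)))\<^sup>2) *\<^sub>R snd (\<gamma> t)) (at t)"
      "\<And>t. t \<in> J \<Longrightarrow> ((\<lambda>t. snd (\<gamma> t)) has_vector_derivative
        (1 / n (fst (\<gamma> t))) *\<^sub>R grad n (fst (\<gamma> t))) (at t)"
    using orbit[unfolded orbit_iff[OF R]] by auto
  have f: "continuous_on J ?f"
    using orbit_continuous[OF R orbit] by (intro continuous_intros)
  then have f': "continuous_on J (\<lambda>t. inverse (?f t))"
    by (intro continuous_on_inverse) auto
  have pos: "inverse (?f t) > 0" for t using n_pos by simp
  obtain \<nu> I where I: "open_interval I" and \<nu>: "\<nu> ` I = J" "\<And>s. s \<in> I \<Longrightarrow> \<nu> s \<in> J"
    "\<And>s. s \<in> I \<Longrightarrow> (\<nu> has_real_derivative inverse (inverse (?f (\<nu> s)))) (at s)"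
    using time_change[OF J f' pos] by metis
  note d\<nu> = \<nu>(3)[unfolded inverse_inverse_eq]
  have "is_phase_space_ray n I (\<lambda>s. \<gamma> (\<nu> s))"
    unfolding is_phase_space_ray_def
  proof (intro conjI ballI I)
    fix s assume s: "s \<in> I"
    show "optical_hamiltonian n (\<gamma> (\<nu> s)) = 0"
      using \<gamma>[OF \<nu>(2)[OF s]] by (simp add: optical_hypersurface_def)
    show "((\<lambda>s. fst (\<gamma> (\<nu> s))) has_vector_derivative 2 *\<^sub>R snd (\<gamma> (\<nu> s))) (at s)"
      using has_vector_derivative_real_chain[OF d\<nu>[OF s] d\<gamma>(1)[OF \<nu>(2)[OF s]]] by simp
    show "((\<lambda>s. snd (\<gamma> (\<nu> s))) has_vector_derivative
        (2 * n (fst (\<gamma> (\<nu> s)))) *\<^sub>R grad n (fst (\<gamma> (\<nu> s)))) (at s)"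
      using has_vector_derivative_real_chain[OF d\<nu>[OF s] d\<gamma>(2)[OF \<nu>(2)[OF s]]]
      by (simp add: power2_eq_square)
  qed
  moreover have "reparametrises I (\<lambda>s. \<gamma> (\<nu> s)) J \<gamma>"
    unfolding reparametrises_def
  proof (intro exI conjI ballI)
    show "continuous_on I (\<lambda>s. ?f (\<nu> s))"
      using d\<nu> \<nu> by (intro continuous_on_compose2[OF f])
        (auto intro!: continuous_at_imp_continuous_on intro: DERIV_isCont)
  qed (auto simp: \<nu> d\<nu> n_pos)
  ultimately show ?thesis by blast
qed

lemma rays_correspond_to_reeb_orbits:
  assumes R: "\<forall>z\<in>\<Sigma>. R z = reeb z"
  shows "rays_correspond_to_orbits n R"
  unfolding rays_correspond_to_orbits_def Let_def
  by (intro conjI allI impI; rule ray_to_orbit[OF R] orbit_to_ray[OF R]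
      orbit_of_ray_unique[OF R] ray_of_orbit_unique[OF R]
      phase_space_ray_to_orbit[OF R] orbit_to_phase_space_ray[OF R]; assumption)

end

theorem theorem4p3:
  fixes n :: "real^3 \<Rightarrow> real" and X :: "phase \<Rightarrow> phase"
  assumes n_smooth: "smooth_on UNIV n"
    and n_pos: "\<And>q. n q > 0"
    and X_hamiltonian: "is_hamiltonian_vector_field (optical_hamiltonian n) X"
  shows "contact_manifold_5 (optical_hypersurface n) (optical_contact_form n) \<and>
    (\<exists>!R. reeb_field_5 (optical_hypersurface n) (optical_contact_form n) R) \<and>
    (\<forall>R. reeb_field_5 (optical_hypersurface n) (optical_contact_form n) R \<longrightarrow>
       (\<forall>z\<in>optical_hypersurface n. X z = (2 * (n (fst z))\<^sup>2) *\<^sub>R R z) \<and>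
       rays_correspond_to_orbits n R)"
proof -
  interpret optical_medium n
    using n_smooth n_pos by unfold_locales
  \<comment> \<open>Agreement on \<Sigma> becomes equality of functions because vector fields are
    extensional.\<close>
  have "R = restrict reeb \<Sigma>" if "reeb_field_5 \<Sigma> \<alpha> R" for R
    using that reeb_field_unique[OF that]
    by (intro extensionalityI[of _ \<Sigma>]) (auto simp: reeb_field_5_def vector_field_on_def)
  then have "\<exists>!R. reeb_field_5 \<Sigma> \<alpha> R"
    using reeb_field_reeb by blast
  moreover have "X z = (2 * (n (fst z))\<^sup>2) *\<^sub>R R z" if "reeb_field_5 \<Sigma> \<alpha> R" "z \<in> \<Sigma>" for R z
    unfolding reeb_field_unique[OF that] hamiltonian_vector_field_eq[OF X_hamiltonian]
    by (simp add: reeb_def power2_eq_square)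
  moreover have "rays_correspond_to_orbits n R" if "reeb_field_5 \<Sigma> \<alpha> R" for R
    using reeb_field_unique[OF that] by (intro rays_correspond_to_reeb_orbits) blast
  ultimately show ?thesis
    using contact_manifold_hypersurface by blast
qed

end
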